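(* Let $G$ be a small category and let $s : G \rightarrow \mathrm{Top}^{\mathrm{op}}$ be a category dynamical system such that for each $e \in \mathrm{ob}(G)$ the space $s(e)$ is a nonempty compact Hausdorff space. Consider the following four assertions: (i) the skew category algebra $\left[ \bigoplus_{e \in \mathrm{ob}(G)} C(e) \right] \rtimes^{\sigma} G$ is simple; (ii) $G$ is inverse connected; (iii) $s$ is minimal; (iv) $s$ is faithful. The following conclusions hold: (a) (i) implies (ii), (iii) and (iv); (b) if $G$ is a locally abelian groupoid, then (i) holds if and only if (ii), (iii) and (iv) all hold; (c) if $G$ is a groupoid with the property that for each $e \in \mathrm{ob}(G)$ the space $s(e)$ is infinite and the group $G_e$ is isomorphic to $\mathbb{Z}$, then (i) holds if and only if (ii) and (iii) both hold.
   Context: For a small category $G$: $\mathrm{ob}(G)$ is its set of objects and $\mathrm{mor}(G)$ its set of morphisms; $n \in G$ means $n \in \mathrm{mor}(G)$. An object is identified with its identity morphism. The domain and codomain of a morphism $n$ are $d(n)$ and $c(n)$; the product $mn$ is defined exactly when $d(m)=c(n)$, and $G^{(2)}$ is the set of such composable pairs $(m,n)$. For $e \in \mathrm{ob}(G)$, $G_e$ is the monoid of all $n$ with $d(n)=c(n)=e$. A groupoid is a category all of whose morphisms are isomorphisms. $G$ is locally abelian if each monoid $G_e$ is abelian. $G$ is inverse connected if for all $e,f \in \mathrm{ob}(G)$ there are $m,n \in \mathrm{mor}(G)$ with $d(m)=c(n)=f$ and $mn=e$ (the identity of $e$). A category dynamical system is a (covariant) functor $s : G \to \mathrm{Top}^{\mathrm{op}}$,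 where $\mathrm{Top}$ is the category of topological spaces and continuous maps. Thus each $n \in G$ gives a continuous function $s(n) : s(c(n)) \to s(d(n))$, with $s(e)=\mathrm{id}_{s(e)}$ for objects $e$ and $s(mn) = s(n)\circ s(m)$ (ordinary composition of functions) for $(m,n) \in G^{(2)}$. $s$ is minimal if for each $e \in \mathrm{ob}(G)$ there is no nonempty proper closed subset $Y$ of $s(e)$ such that $s(n)(Y) \subseteq Y$ for all $n \in G_e$. $s$ is faithful if for each $e \in \mathrm{ob}(G)$ and each nonidentity $n \in G_e$ there is $x \in s(e)$ with $s(n)(x) \neq x$. $C(e)$ is the ring of continuous complex-valued functions on $s(e)$, with pointwise operations. For $n \in G$, $\sigma(n) : C(d(n)) \to C(c(n))$ is defined by $\sigma(n)(f) = f \circ s(n)$. The skew category algebra $\left[ \bigoplus_{e} C(e) \right] \rtimes^{\sigma} G$ is the set of formal sums $\sum_{n \in G} a_n u_n$ with $a_n \in C(c(n))$, all but finitely many $a_n$ being zero, with componentwise addition and multiplication determined biadditively by $(a u_m)(b u_n) = a\,\sigma(m)(b)\, u_{mn}$ if $(m,n) \in G^{(2)}$ and $(a u_m)(b u_n) = 0$ otherwise. It is an associative ring, not necessarily unital. Ideals are two-sided. A ring is simple if it has no nontrivial ideal, i.e. no ideal that is both nonzero and proper. *)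

theory Defs
  imports "HOL-Analysis.Analysis" "HOL-Algebra.Elementary_Groups" "HOL-Algebra.AbelCoset"
begin

section \<open>Small categories\<close>

text \<open>Objects are identified with their identity morphisms, so \<open>Ob G\<close> is a subset of
  \<open>Mor G\<close>. The product \<open>m \<cdot>\<^bsub>G\<^esub> n\<close> is only meaningful if \<open>Dom G m = Cod G n\<close>.\<close>

record 'm category =
  Ob :: "'m set"
  Mor :: "'m set"
  Dom :: "'m \<Rightarrow> 'm"
  Cod :: "'m \<Rightarrow> 'm"
  Comp :: "'m \<Rightarrow> 'm \<Rightarrow> 'm"  (infixl \<open>\<cdot>\<index>\<close> 70)

locale small_category =
  fixes G :: "'m category" (structure)
  assumes Ob_subset: "Ob G \<subseteq> Mor G"
    and Dom_closed: "n \<in> Mor G \<Longrightarrow> Dom G n \<in> Ob G"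
    and Cod_closed: "n \<in> Mor G \<Longrightarrow> Cod G n \<in> Ob G"
    and Dom_Ob: "e \<in> Ob G \<Longrightarrow> Dom G e = e"
    and Cod_Ob: "e \<in> Ob G \<Longrightarrow> Cod G e = e"
    and Comp_closed: "\<lbrakk>m \<in> Mor G; n \<in> Mor G; Dom G m = Cod G n\<rbrakk> \<Longrightarrow> m \<cdot> n \<in> Mor G"
    and Dom_Comp: "\<lbrakk>m \<in> Mor G; n \<in> Mor G; Dom G m = Cod G n\<rbrakk> \<Longrightarrow> Dom G (m \<cdot> n) = Dom G n"
    and Cod_Comp: "\<lbrakk>m \<in> Mor G; n \<in> Mor G; Dom G m = Cod G n\<rbrakk> \<Longrightarrow> Cod G (m \<cdot> n) = Cod G m"
    and Comp_assoc: "\<lbrakk>l \<in> Mor G; m \<in> Mor G; n \<in> Mor G; Dom G l = Cod G m; Dom G m = Cod G n\<rbrakk>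
      \<Longrightarrow> (l \<cdot> m) \<cdot> n = l \<cdot> (m \<cdot> n)"
    and Comp_Dom: "n \<in> Mor G \<Longrightarrow> n \<cdot> Dom G n = n"
    and Cod_Comp_left: "n \<in> Mor G \<Longrightarrow> Cod G n \<cdot> n = n"

definition composable :: "'m category \<Rightarrow> ('m \<times> 'm) set" where
  "composable G = {(m, n). m \<in> Mor G \<and> n \<in> Mor G \<and> Dom G m = Cod G n}"

definition local_monoid :: "'m category \<Rightarrow> 'm \<Rightarrow> 'm monoid" where
  "local_monoid G e =
    \<lparr>carrier = {n \<in> Mor G. Dom G n = e \<and> Cod G n = e}, mult = Comp G, one = e\<rparr>"

definition groupoid :: "'m category \<Rightarrow> bool" where
  "groupoid G \<longleftrightarrow> small_category G \<and>
    (\<forall>n \<in> Mor G. \<exists>k \<in> Mor G. Dom G k = Cod G n \<and> Cod G k = Dom G n \<and>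
      n \<cdot>\<^bsub>G\<^esub> k = Cod G n \<and> k \<cdot>\<^bsub>G\<^esub> n = Dom G n)"

definition locally_abelian :: "'m category \<Rightarrow> bool" where
  "locally_abelian G \<longleftrightarrow> (\<forall>e \<in> Ob G. comm_monoid (local_monoid G e))"

definition inverse_connected :: "'m category \<Rightarrow> bool" where
  "inverse_connected G \<longleftrightarrow>
    (\<forall>e \<in> Ob G. \<forall>f \<in> Ob G. \<exists>m \<in> Mor G. \<exists>n \<in> Mor G.
      Dom G m = f \<and> Cod G n = f \<and> m \<cdot>\<^bsub>G\<^esub> n = e)"


section \<open>Category dynamical systems\<close>

text \<open>The functor is split into its object part \<open>X\<close> and its morphism part \<open>s\<close>. All spaces live on
  subsets of one type; \<open>X e\<close> is relevant only for objects \<open>e\<close>, and \<open>s n\<close> only on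
  \<open>topspace (X (Cod G n))\<close>.\<close>

locale category_dynamical_system = small_category G
  for G :: "'m category" (structure) +
  fixes X :: "'m \<Rightarrow> 'x topology"
    and s :: "'m \<Rightarrow> 'x \<Rightarrow> 'x"
  assumes continuous: "n \<in> Mor G \<Longrightarrow> continuous_map (X (Cod G n)) (X (Dom G n)) (s n)"
    and s_Ob: "\<lbrakk>e \<in> Ob G; p \<in> topspace (X e)\<rbrakk> \<Longrightarrow> s e p = p"
    and s_Comp: "\<lbrakk>(m, n) \<in> composable G; p \<in> topspace (X (Cod G m))\<rbrakk>
      \<Longrightarrow> s (m \<cdot> n) p = s n (s m p)"

definition minimal :: "'m category \<Rightarrow> ('m \<Rightarrow> 'x topology) \<Rightarrow> ('m \<Rightarrow> 'x \<Rightarrow> 'x) \<Rightarrow> bool" where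
  "minimal G X s \<longleftrightarrow>
    (\<forall>e \<in> Ob G. \<not> (\<exists>Y. closedin (X e) Y \<and> Y \<noteq> {} \<and> Y \<noteq> topspace (X e) \<and>
      (\<forall>n \<in> carrier (local_monoid G e). s n ` Y \<subseteq> Y)))"

definition faithful :: "'m category \<Rightarrow> ('m \<Rightarrow> 'x topology) \<Rightarrow> ('m \<Rightarrow> 'x \<Rightarrow> 'x) \<Rightarrow> bool" where
  "faithful G X s \<longleftrightarrow>
    (\<forall>e \<in> Ob G. \<forall>n \<in> carrier (local_monoid G e). n \<noteq> e \<longrightarrow>
      (\<exists>p \<in> topspace (X e). s n p \<noteq> p))"


section \<open>The skew category algebra\<close>

text \<open>A function on a space is represented by its extension by zero to the whole type, so that
  equality of representatives is equality of functions and the pointwise sum and product of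
  representatives represent the sum and product.\<close>

definition cont_fun :: "'x topology \<Rightarrow> ('x \<Rightarrow> complex) set" where
  "cont_fun T = {f. continuous_map T euclidean f \<and> (\<forall>p. p \<notin> topspace T \<longrightarrow> f p = 0)}"

definition sigma_map ::
  "'m category \<Rightarrow> ('m \<Rightarrow> 'x topology) \<Rightarrow> ('m \<Rightarrow> 'x \<Rightarrow> 'x) \<Rightarrow> 'm \<Rightarrow> ('x \<Rightarrow> complex) \<Rightarrow> 'x \<Rightarrow> complex"
  where "sigma_map G X s n f = (\<lambda>p. if p \<in> topspace (X (Cod G n)) then f (s n p) else 0)"

text \<open>The formal sum with coefficients \<open>a n\<close> is the function \<open>a\<close>, with value zero outside \<open>Mor G\<close>.\<close>

definition skew_carrier :: "'m category \<Rightarrow> ('m \<Rightarrow> 'x topology) \<Rightarrow> ('m \<Rightarrow> 'x \<Rightarrow> complex) set" where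
  "skew_carrier G X =
    {a. (\<forall>n \<in> Mor G. a n \<in> cont_fun (X (Cod G n))) \<and>
        (\<forall>n. n \<notin> Mor G \<longrightarrow> a n = (\<lambda>_. 0)) \<and>
        finite {n. a n \<noteq> (\<lambda>_. 0)}}"

text \<open>The algebra need not be unital. The record type nevertheless demands a field \<open>one\<close>; it is
  filled with the formal sum of all identities, which lies in the carrier only if all but finitely
  many of its coefficients vanish. Nothing below depends on that field.

  The coefficient of a product at \<open>l\<close> collects the terms \<open>a m \<cdot> \<sigma>(m)(b n)\<close> with \<open>m n = l\<close>; the sum
  is restricted to the supports only to make it finite.\<close>

definition skew_category_algebra ::
  "'m category \<Rightarrow> ('m \<Rightarrow> 'x topology) \<Rightarrow> ('m \<Rightarrow> 'x \<Rightarrow> 'x) \<Rightarrow> ('m \<Rightarrow> 'x \<Rightarrow> complex) ring" where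
  "skew_category_algebra G X s =
    \<lparr>carrier = skew_carrier G X,
     mult = (\<lambda>a b l p. \<Sum>(m, n) \<in> {(m, n) \<in> composable G. m \<cdot>\<^bsub>G\<^esub> n = l \<and>
         a m \<noteq> (\<lambda>_. 0) \<and> b n \<noteq> (\<lambda>_. 0)}. a m p * sigma_map G X s m (b n) p),
     one = (\<lambda>n p. if n \<in> Ob G \<and> p \<in> topspace (X n) then 1 else 0),
     zero = (\<lambda>n p. 0),
     add = (\<lambda>a b n p. a n p + b n p)\<rparr>"

text \<open>The library's \<open>ideal\<close> presupposes a unital ring; these are its remaining axioms.\<close>

definition two_sided_ideal :: "'a set \<Rightarrow> ('a, 'b) ring_scheme \<Rightarrow> bool" where
  "two_sided_ideal I R \<longleftrightarrow> additive_subgroup I R \<and>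
    (\<forall>x \<in> I. \<forall>a \<in> carrier R. a \<otimes>\<^bsub>R\<^esub> x \<in> I \<and> x \<otimes>\<^bsub>R\<^esub> a \<in> I)"

definition simple_ring :: "('a, 'b) ring_scheme \<Rightarrow> bool" where
  "simple_ring R \<longleftrightarrow> \<not> (\<exists>I. two_sided_ideal I R \<and> I \<noteq> {\<zero>\<^bsub>R\<^esub>} \<and> I \<noteq> carrier R)"

end

theory Submission
  imports Defs
begin

text \<open>
  Write \<open>f u\<^sub>n\<close> for the monomial with coefficient \<open>f\<close> at \<open>n\<close>, and \<open>u\<^sub>n\<close> if \<open>f = 1\<close>.

  Necessity of each condition holds for any category: if the condition fails, there is an ideal
  that contains some nonzero element but misses some \<open>u\<^sub>e\<close>.  If \<open>e\<close> does not factor through \<open>f\<close>,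
  take the elements supported on morphisms that do.  If \<open>Y\<close> is a nonempty proper closed invariant
  set at \<open>e\<close>, take the elements whose coefficients vanish on all translates of \<open>Y\<close>.  If \<open>n \<noteq> e\<close> acts trivially on
  the space at \<open>e\<close>, take the kernel of the action of the algebra on functions on the spaces, which
  contains \<open>u\<^sub>e - u\<^sub>n\<close>.

  For sufficiency, let \<open>I\<close> be a nonzero ideal over a locally abelian groupoid.  Invertibility of
  morphisms lets one move a nonzero coefficient of an element of \<open>I\<close> to an identity \<open>e\<close> and cut the
  support down to the group \<open>G\<^sub>e\<close>.  An element of smallest support of this kind commutes with all
  functions on \<open>X e\<close>, since a commutator has smaller support; this forces \<open>s n\<close> to fix the points
  where the coefficient at \<open>n\<close> is nonzero (\<open>ideal_element_fixing_its_support\<close>).  Fixed point sets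
  are invariant as \<open>G\<^sub>e\<close> is abelian, so minimality and faithfulness leave only \<open>n = e\<close>, and \<open>I\<close>
  contains some \<open>f u\<^sub>e\<close> with \<open>f \<noteq> 0\<close> (\<open>ideal_contains_function\<close>).  By minimality the functions
  \<open>f\<close> with \<open>f u\<^sub>e \<in> I\<close> have no common zero, so by compactness \<open>u\<^sub>e \<in> I\<close>
  (\<open>ideal_contains_unit\<close>), and connectedness spreads this to the whole algebra
  (\<open>ideal_eq_carrier_if_unit\<close>).

  For groups isomorphic to \<open>\<int>\<close> and infinite spaces faithfulness follows from minimality: a nontrivial
  kernel would make all orbits finite (\<open>faithful_if_infinite_cyclic\<close>).
\<close>

section \<open>Continuous complex functions extended by zero\<close>

lemma continuous_map_mult_complex:
  fixes f g :: "'x \<Rightarrow> complex"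
  assumes "continuous_map T euclidean f" "continuous_map T euclidean g"
  shows "continuous_map T euclidean (\<lambda>p. f p * g p)"
  using assms by (simp add: continuous_map_atin tendsto_mult)

lemma cont_fun_outside: "f \<in> cont_fun T \<Longrightarrow> p \<notin> topspace T \<Longrightarrow> f p = 0"
  by (simp add: cont_fun_def)

lemma cont_fun_zero [simp]: "(\<lambda>_. 0) \<in> cont_fun T"
  by (simp add: cont_fun_def)

lemma cont_fun_add:
  "f \<in> cont_fun T \<Longrightarrow> g \<in> cont_fun T \<Longrightarrow> (\<lambda>p. f p + g p) \<in> cont_fun T"
  by (auto simp: cont_fun_def intro: continuous_map_add)

lemma cont_fun_uminus: "f \<in> cont_fun T \<Longrightarrow> (\<lambda>p. - f p) \<in> cont_fun T"
  by (auto simp: cont_fun_def intro: continuous_map_minus)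

lemma cont_fun_mult:
  "f \<in> cont_fun T \<Longrightarrow> g \<in> cont_fun T \<Longrightarrow> (\<lambda>p. f p * g p) \<in> cont_fun T"
  by (auto simp: cont_fun_def intro: continuous_map_mult_complex)

lemma cont_fun_sum:
  "(\<And>i. i \<in> S \<Longrightarrow> f i \<in> cont_fun T) \<Longrightarrow> (\<lambda>p. \<Sum>i\<in>S. f i p) \<in> cont_fun T"
  by (induction S rule: infinite_finite_induct) (auto intro: cont_fun_add)

lemma cont_fun_cnj: "f \<in> cont_fun T \<Longrightarrow> (\<lambda>p. cnj (f p)) \<in> cont_fun T"
  by (auto simp: cont_fun_def continuous_map_atin tendsto_cnj)

lemma cont_fun_inverse:
  assumes "f \<in> cont_fun T" and "\<And>p. p \<in> topspace T \<Longrightarrow> f p \<noteq> 0"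
  shows "(\<lambda>p. inverse (f p)) \<in> cont_fun T"
  using assms by (auto simp: cont_fun_def continuous_map_atin intro: tendsto_inverse)

definition one_on :: "'x topology \<Rightarrow> 'x \<Rightarrow> complex" where
  "one_on T = (\<lambda>p. if p \<in> topspace T then 1 else 0)"

lemma one_on_cont_fun: "one_on T \<in> cont_fun T"
  unfolding cont_fun_def one_on_def
  by (auto intro: continuous_map_eq [of _ _ "\<lambda>_. 1"])

lemma one_on_nonzero: "topspace T \<noteq> {} \<Longrightarrow> one_on T \<noteq> (\<lambda>_. 0)"
  by (metis ex_in_conv one_on_def one_neq_zero)

text \<open>Urysohn's lemma, with a point as one of the closed sets.  It is the only source of
  nonconstant functions in what follows.\<close>

lemma cont_fun_separates:
  assumes "compact_space T" "Hausdorff_space T" "closedin T Y" "q \<in> topspace T" "q \<notin> Y"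
  obtains f where "f \<in> cont_fun T" "f q = 1" "\<And>p. p \<in> Y \<Longrightarrow> f p = 0"
proof -
  have "normal_space T"
    using assms compact_Hausdorff_or_regular_imp_normal_space by blast
  moreover have "closedin T {q}"
    using assms by (simp add: closedin_Hausdorff_singleton)
  ultimately obtain g :: "'a \<Rightarrow> real"
    where g: "continuous_map T euclideanreal g" "g ` Y \<subseteq> {0}" "g ` {q} \<subseteq> {1}"
    using Urysohn_lemma_alt [of T Y "{q}" 0 1] assms by (auto simp: disjnt_def)
  define f where "f = (\<lambda>p. if p \<in> topspace T then complex_of_real (g p) else 0)"
  have "continuous_map T euclidean (\<lambda>p. complex_of_real (g p))"
    using g(1) by (simp add: continuous_map_atin tendsto_of_real)
  then have "continuous_map T euclidean f"
    by (rule continuous_map_eq) (simp add: f_def)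
  then have "f \<in> cont_fun T"
    by (simp add: cont_fun_def f_def)
  moreover have "f q = 1" "\<And>p. p \<in> Y \<Longrightarrow> f p = 0"
    using g assms(4) by (auto simp: f_def)
  ultimately show thesis using that by blast
qed

text \<open>Cover the compact space by finitely many of the sets where some member of \<open>J\<close> is nonzero.  The
  sum of the \<open>\<bar>f\<bar>\<^sup>2\<close> over these members \<open>f\<close> belongs to \<open>J\<close> and has no zero, so it is a unit.\<close>

lemma ideal_of_cont_fun_without_common_zero:
  assumes "compact_space T"
    and J: "J \<subseteq> cont_fun T" "(\<lambda>_. 0) \<in> J"
      "\<And>f g. f \<in> J \<Longrightarrow> g \<in> J \<Longrightarrow> (\<lambda>p. f p + g p) \<in> J"
      "\<And>f g. f \<in> J \<Longrightarrow> g \<in> cont_fun T \<Longrightarrow> (\<lambda>p. g p * f p) \<in> J"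
    and no_zero: "\<And>p. p \<in> topspace T \<Longrightarrow> \<exists>f\<in>J. f p \<noteq> 0"
  shows "one_on T \<in> J"
proof -
  define U where "U f = {p \<in> topspace T. f p \<noteq> 0}" for f :: "'a \<Rightarrow> complex"
  have "openin T (U f)" if "f \<in> J" for f
    using openin_continuous_map_preimage [of T euclidean f "- {0}"] that J(1)
    by (auto simp: U_def cont_fun_def)
  moreover have "\<Union> (U ` J) = topspace T"
    using no_zero by (auto simp: U_def)
  ultimately have "\<exists>\<F>. finite \<F> \<and> \<F> \<subseteq> U ` J \<and> \<Union> \<F> = topspace T"
    using assms(1) unfolding compact_space by (metis (no_types, lifting) imageE)
  then obtain F where F: "finite F" "F \<subseteq> J" "\<Union> (U ` F) = topspace T"
    by (metis finite_subset_image)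
  define g where "g = (\<lambda>p. \<Sum>f\<in>F. cnj (f p) * f p)"
  have "finite H \<Longrightarrow> H \<subseteq> J \<Longrightarrow> (\<lambda>p. \<Sum>f\<in>H. cnj (f p) * f p) \<in> J" for H
  proof (induction H rule: finite_induct)
    case (insert f H)
    then have "(\<lambda>p. cnj (f p) * f p) \<in> J"
      using J(1) by (intro J(4) cont_fun_cnj) auto
    then show ?case using insert J(3) by simp
  qed (simp add: J(2))
  then have gJ: "g \<in> J" using F by (simp add: g_def)
  have g_nonzero: "g p \<noteq> 0" if p: "p \<in> topspace T" for p
  proof -
    obtain f where f: "f \<in> F" "f p \<noteq> 0" using p F(3) by (auto simp: U_def)
    have "g p = complex_of_real (\<Sum>f\<in>F. (cmod (f p))\<^sup>2)"
      unfolding g_def of_real_sum by (intro sum.cong refl) (simp only: complex_norm_square mult.commute)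
    moreover have "(\<Sum>f\<in>F. (cmod (f p))\<^sup>2) > 0"
      using f F(1) by (intro sum_pos2 [of F f]) auto
    ultimately show ?thesis by (metis less_irrefl of_real_eq_0_iff)
  qed
  have "(\<lambda>p. inverse (g p) * g p) \<in> J"
    using gJ g_nonzero J(1) by (intro J(4) cont_fun_inverse) auto
  moreover have "(\<lambda>p. inverse (g p) * g p) = one_on T"
    using g_nonzero gJ J(1) by (auto simp: one_on_def fun_eq_iff cont_fun_def)
  ultimately show ?thesis by simp
qed

section \<open>The product of the algebra\<close>

definition support :: "('m \<Rightarrow> 'x \<Rightarrow> complex) \<Rightarrow> 'm set" where
  "support a = {n. a n \<noteq> (\<lambda>_. 0)}"

definition monomial :: "'m \<Rightarrow> ('x \<Rightarrow> complex) \<Rightarrow> 'm \<Rightarrow> 'x \<Rightarrow> complex" where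
  "monomial n f = (\<lambda>l. if l = n then f else (\<lambda>_. 0))"

lemma support_monomial: "support (monomial n f) \<subseteq> {n}"
  by (auto simp: support_def monomial_def)

context category_dynamical_system
begin

abbreviation A :: "('m \<Rightarrow> 'x \<Rightarrow> complex) ring" where
  "A \<equiv> skew_category_algebra G X s"

lemma add_A [simp]: "a \<oplus>\<^bsub>A\<^esub> b = (\<lambda>n p. a n p + b n p)"
  by (simp add: skew_category_algebra_def)

lemma zero_A [simp]: "\<zero>\<^bsub>A\<^esub> = (\<lambda>n p. 0)"
  by (simp add: skew_category_algebra_def)

lemma carrier_A: "carrier A = skew_carrier G X"
  by (simp add: skew_category_algebra_def)

lemma coeff_cont: "a \<in> carrier A \<Longrightarrow> n \<in> Mor G \<Longrightarrow> a n \<in> cont_fun (X (Cod G n))"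
  by (simp add: carrier_A skew_carrier_def)

lemma coeff_outside_Mor: "a \<in> carrier A \<Longrightarrow> n \<notin> Mor G \<Longrightarrow> a n = (\<lambda>_. 0)"
  by (simp add: carrier_A skew_carrier_def)

lemma coeff_outside_space:
  "a \<in> carrier A \<Longrightarrow> p \<notin> topspace (X (Cod G n)) \<Longrightarrow> a n p = 0"
  by (metis coeff_cont coeff_outside_Mor cont_fun_outside)

lemma support_finite: "a \<in> carrier A \<Longrightarrow> finite (support a)"
  by (simp add: carrier_A skew_carrier_def support_def)

lemma support_Mor: "a \<in> carrier A \<Longrightarrow> support a \<subseteq> Mor G"
  using coeff_outside_Mor by (auto simp: support_def)

lemma carrierI:
  assumes "\<And>n. n \<in> Mor G \<Longrightarrow> a n \<in> cont_fun (X (Cod G n))"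
    and "\<And>n. n \<notin> Mor G \<Longrightarrow> a n = (\<lambda>_. 0)"
    and "finite S" "support a \<subseteq> S"
  shows "a \<in> carrier A"
  using assms finite_subset [of "support a" S]
  by (auto simp: carrier_A skew_carrier_def support_def)

lemma monomial_closed:
  "n \<in> Mor G \<Longrightarrow> f \<in> cont_fun (X (Cod G n)) \<Longrightarrow> monomial n f \<in> carrier A"
  by (rule carrierI [of _ "{n}"]) (auto simp: monomial_def support_def)

lemma unit_closed: "e \<in> Ob G \<Longrightarrow> monomial e (one_on (X e)) \<in> carrier A"
  using Ob_subset by (auto intro!: monomial_closed simp: Cod_Ob one_on_cont_fun)

lemma s_closed:
  "n \<in> Mor G \<Longrightarrow> p \<in> topspace (X (Cod G n)) \<Longrightarrow> s n p \<in> topspace (X (Dom G n))"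
  using continuous [of n] continuous_map_image_subset_topspace by blast

lemma sigma_cont:
  assumes "n \<in> Mor G" "f \<in> cont_fun (X (Dom G n))"
  shows "sigma_map G X s n f \<in> cont_fun (X (Cod G n))"
proof -
  have "continuous_map (X (Cod G n)) euclidean (f \<circ> s n)"
    using assms continuous by (auto intro: continuous_map_compose simp: cont_fun_def)
  then have "continuous_map (X (Cod G n)) euclidean (sigma_map G X s n f)"
    by (rule continuous_map_eq) (simp add: sigma_map_def)
  then show ?thesis by (simp add: cont_fun_def sigma_map_def)
qed

lemma sigma_map_zero [simp]: "sigma_map G X s n (\<lambda>_. 0) p = 0"
  by (simp add: sigma_map_def)

lemma mult_apply_sigma:
  assumes "finite S" "finite T" "support a \<subseteq> S" "support b \<subseteq> T"
  shows "(a \<otimes>\<^bsub>A\<^esub> b) l p =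
    (\<Sum>m\<in>S. \<Sum>n\<in>T. if (m, n) \<in> composable G \<and> m \<cdot> n = l
      then a m p * sigma_map G X s m (b n) p else 0)"
proof -
  have "(a \<otimes>\<^bsub>A\<^esub> b) l p =
    (\<Sum>(m, n) \<in> {(m, n) \<in> composable G. m \<cdot> n = l \<and> a m \<noteq> (\<lambda>_. 0) \<and> b n \<noteq> (\<lambda>_. 0)}.
      a m p * sigma_map G X s m (b n) p)"
    by (simp add: skew_category_algebra_def)
  also have "\<dots> = (\<Sum>(m, n) \<in> S \<times> T. if (m, n) \<in> composable G \<and> m \<cdot> n = l
      then a m p * sigma_map G X s m (b n) p else 0)"
    using assms
    by (intro sum.mono_neutral_cong_left)
      (auto simp: support_def split: if_splits)
  finally show ?thesis by (simp add: sum.cartesian_product)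
qed

text \<open>Since \<open>a m\<close> vanishes off the domain of \<open>s m\<close>, the truncation in \<open>sigma_map\<close> is invisible in
  products.\<close>

lemma mult_apply:
  assumes "a \<in> carrier A" "finite S" "finite T" "support a \<subseteq> S" "support b \<subseteq> T"
  shows "(a \<otimes>\<^bsub>A\<^esub> b) l p =
    (\<Sum>m\<in>S. \<Sum>n\<in>T. if (m, n) \<in> composable G \<and> m \<cdot> n = l then a m p * b n (s m p) else 0)"
  unfolding mult_apply_sigma [OF assms(2-5)]
  using assms(1) by (intro sum.cong refl) (auto simp: sigma_map_def coeff_outside_space)

lemma mult_support:
  assumes "a \<in> carrier A"
  shows "support (a \<otimes>\<^bsub>A\<^esub> b) \<subseteq>
    {m \<cdot> n | m n. (m, n) \<in> composable G \<and> m \<in> support a \<and> n \<in> support b}"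
proof
  fix l assume "l \<in> support (a \<otimes>\<^bsub>A\<^esub> b)"
  then obtain p where "(a \<otimes>\<^bsub>A\<^esub> b) l p \<noteq> 0" by (auto simp: support_def fun_eq_iff)
  then have "{(m, n) \<in> composable G. m \<cdot> n = l \<and> a m \<noteq> (\<lambda>_. 0) \<and> b n \<noteq> (\<lambda>_. 0)} \<noteq> {}"
    unfolding skew_category_algebra_def monoid.simps by (metis (no_types, lifting) sum.empty)
  then show "l \<in> {m \<cdot> n | m n. (m, n) \<in> composable G \<and> m \<in> support a \<and> n \<in> support b}"
    by (auto simp: support_def)
qed

lemma mult_closed:
  assumes a: "a \<in> carrier A" and b: "b \<in> carrier A"
  shows "a \<otimes>\<^bsub>A\<^esub> b \<in> carrier A"
proof (rule carrierI)
  note fin = support_finite [OF a] support_finite [OF b]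
  show "finite ((\<lambda>(m, n). m \<cdot> n) ` (support a \<times> support b))"
    using fin by simp
  show "support (a \<otimes>\<^bsub>A\<^esub> b) \<subseteq> (\<lambda>(m, n). m \<cdot> n) ` (support a \<times> support b)"
    using mult_support [OF a, of b] by auto
  show "(a \<otimes>\<^bsub>A\<^esub> b) l = (\<lambda>_. 0)" if "l \<notin> Mor G" for l
  proof -
    have "l \<notin> support (a \<otimes>\<^bsub>A\<^esub> b)"
      using mult_support [OF a, of b] that Comp_closed by (auto simp: composable_def)
    then show ?thesis by (simp add: support_def)
  qed
  show "(a \<otimes>\<^bsub>A\<^esub> b) l \<in> cont_fun (X (Cod G l))" if "l \<in> Mor G" for l
  proof -
    have "(\<lambda>p. if (m, n) \<in> composable G \<and> m \<cdot> n = l then a m p * sigma_map G X s m (b n) p else 0)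
      \<in> cont_fun (X (Cod G l))" for m n
    proof (cases "(m, n) \<in> composable G \<and> m \<cdot> n = l")
      case True
      then have mn: "m \<in> Mor G" "n \<in> Mor G" "Dom G m = Cod G n" "m \<cdot> n = l"
        by (auto simp: composable_def)
      then have "Cod G l = Cod G m" using Cod_Comp by auto
      then have "(\<lambda>p. a m p * sigma_map G X s m (b n) p) \<in> cont_fun (X (Cod G l))"
        using mn a b by (auto intro!: cont_fun_mult sigma_cont simp: coeff_cont)
      then show ?thesis using True by simp
    qed (simp only: if_False cont_fun_zero)
    then have "(\<lambda>p. \<Sum>m\<in>support a. \<Sum>n\<in>support b.
        if (m, n) \<in> composable G \<and> m \<cdot> n = l then a m p * sigma_map G X s m (b n) p else 0)
      \<in> cont_fun (X (Cod G l))"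
      by (intro cont_fun_sum)
    then show ?thesis
      by (subst (asm) mult_apply_sigma [symmetric, OF fin order_refl order_refl])
  qed
qed

lemma mult_monomial:
  assumes "m \<in> Mor G" "n \<in> Mor G" "Dom G m = Cod G n" "f \<in> cont_fun (X (Cod G m))"
  shows "monomial m f \<otimes>\<^bsub>A\<^esub> monomial n g = monomial (m \<cdot> n) (\<lambda>p. f p * g (s m p))"
  using assms mult_apply [OF monomial_closed [OF assms(1,4)] _ _ support_monomial
      support_monomial, of n g]
  by (auto simp: fun_eq_iff monomial_def composable_def)

lemma mult_object_left:
  assumes e: "e \<in> Ob G" and f: "f \<in> cont_fun (X e)" and a: "a \<in> carrier A"
  shows "(monomial e f \<otimes>\<^bsub>A\<^esub> a) l p = (if Cod G l = e then f p * a l p else 0)"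
proof -
  have eM: "e \<in> Mor G" "Dom G e = e" "Cod G e = e"
    using e Ob_subset Dom_Ob Cod_Ob by auto
  have 1: "((e, n) \<in> composable G \<and> e \<cdot> n = l) \<longleftrightarrow> (n = l \<and> l \<in> Mor G \<and> Cod G l = e)" for n
    using eM Cod_Comp_left by (auto simp: composable_def)
  have 2: "f p * a l (s e p) = f p * a l p"
    using cont_fun_outside [OF f] s_Ob [OF e] by (cases "p \<in> topspace (X e)") auto
  have "(monomial e f \<otimes>\<^bsub>A\<^esub> a) l p = (\<Sum>m\<in>{e}. \<Sum>n\<in>insert l (support a).
      if (m, n) \<in> composable G \<and> m \<cdot> n = l then monomial e f m p * a n (s m p) else 0)"
    using support_finite [OF a] f eM
    by (intro mult_apply monomial_closed support_monomial) auto
  also have "\<dots> = (\<Sum>n\<in>insert l (support a).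
      if n = l then (if l \<in> Mor G \<and> Cod G l = e then f p * a l (s e p) else 0) else 0)"
    by (auto simp: 1 monomial_def intro!: sum.cong)
  also have "\<dots> = (if l \<in> Mor G \<and> Cod G l = e then f p * a l p else 0)"
    using support_finite [OF a] 2 by simp
  also have "\<dots> = (if Cod G l = e then f p * a l p else 0)"
    using coeff_outside_Mor [OF a] by auto
  finally show ?thesis .
qed

text \<open>Right multiplication by a monomial at an isomorphism merely translates coefficients, because
  \<open>m \<cdot> k = l\<close> has the unique solution \<open>m = l \<cdot> k'\<close>.  For a general morphism several
  coefficients could be added up.\<close>

lemma mult_iso_right:
  assumes k: "k \<in> Mor G" "k' \<in> Mor G" "Dom G k' = Cod G k" "Cod G k' = Dom G k"
      "k \<cdot> k' = Cod G k" "k' \<cdot> k = Dom G k"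
    and a: "a \<in> carrier A"
  shows "(a \<otimes>\<^bsub>A\<^esub> monomial k g) l p =
    (if l \<in> Mor G \<and> Dom G l = Dom G k then a (l \<cdot> k') p * g (s (l \<cdot> k') p) else 0)"
proof -
  have 1: "((m, k) \<in> composable G \<and> m \<cdot> k = l) \<longleftrightarrow>
    (m = l \<cdot> k' \<and> l \<in> Mor G \<and> Dom G l = Dom G k)" for m
  proof
    assume "(m, k) \<in> composable G \<and> m \<cdot> k = l"
    then have m: "m \<in> Mor G" "Dom G m = Cod G k" "l = m \<cdot> k" by (auto simp: composable_def)
    then show "m = l \<cdot> k' \<and> l \<in> Mor G \<and> Dom G l = Dom G k"
      using k Comp_assoc [of m k k'] Comp_Dom [of m] Dom_Comp Comp_closed by metis
  next
    assume m: "m = l \<cdot> k' \<and> l \<in> Mor G \<and> Dom G l = Dom G k"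
    then show "(m, k) \<in> composable G \<and> m \<cdot> k = l"
      using k Comp_assoc [of l k' k] Comp_Dom [of l] Dom_Comp [of l k'] Comp_closed [of l k']
      by (auto simp: composable_def)
  qed
  have "(a \<otimes>\<^bsub>A\<^esub> monomial k g) l p = (\<Sum>m\<in>insert (l \<cdot> k') (support a). \<Sum>n\<in>{k}.
      if (m, n) \<in> composable G \<and> m \<cdot> n = l then a m p * monomial k g n (s m p) else 0)"
    using support_finite [OF a] by (intro mult_apply a support_monomial) auto
  also have "\<dots> = (\<Sum>m\<in>insert (l \<cdot> k') (support a).
      if m = l \<cdot> k' then
        (if l \<in> Mor G \<and> Dom G l = Dom G k then a (l \<cdot> k') p * g (s (l \<cdot> k') p) else 0) else 0)"
    by (intro sum.cong refl) (auto simp: 1 monomial_def)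
  also have "\<dots> = (if l \<in> Mor G \<and> Dom G l = Dom G k then a (l \<cdot> k') p * g (s (l \<cdot> k') p) else 0)"
    using support_finite [OF a] by simp
  finally show ?thesis .
qed

lemma mult_object_right:
  assumes e: "e \<in> Ob G" and a: "a \<in> carrier A"
  shows "(a \<otimes>\<^bsub>A\<^esub> monomial e g) l p = (if Dom G l = e then a l p * g (s l p) else 0)"
proof -
  have eM: "e \<in> Mor G" "Dom G e = e" "Cod G e = e"
    using e Ob_subset Dom_Ob Cod_Ob by auto
  then have "e \<cdot> e = e" using Comp_Dom [of e] by simp
  then have "(a \<otimes>\<^bsub>A\<^esub> monomial e g) l p =
    (if l \<in> Mor G \<and> Dom G l = e then a (l \<cdot> e) p * g (s (l \<cdot> e) p) else 0)"
    using mult_iso_right [of e e a g l p] eM a by simp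
  then show ?thesis
    using Comp_Dom [of l] coeff_outside_Mor [OF a, of l] by auto
qed

lemma add_closed:
  assumes "a \<in> carrier A" "b \<in> carrier A"
  shows "(\<lambda>n p. a n p + b n p) \<in> carrier A"
  using assms coeff_cont coeff_outside_Mor support_finite
  by (intro carrierI [of _ "support a \<union> support b"])
    (auto simp: support_def intro: cont_fun_add)

lemma neg_closed: "a \<in> carrier A \<Longrightarrow> (\<lambda>n p. - a n p) \<in> carrier A"
  using coeff_cont coeff_outside_Mor support_finite
  by (intro carrierI [of _ "support a"]) (auto simp: support_def intro: cont_fun_uminus)

text \<open>The point is that the inverse in the additive group, which \<open>two_sided_ideal\<close> refers to, is the
  coefficientwise negative.\<close>

lemma two_sided_idealI:
  assumes sub: "I \<subseteq> carrier A" and zero: "(\<lambda>n p. 0) \<in> I"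
    and add: "\<And>a b. a \<in> I \<Longrightarrow> b \<in> I \<Longrightarrow> (\<lambda>n p. a n p + b n p) \<in> I"
    and neg: "\<And>a. a \<in> I \<Longrightarrow> (\<lambda>n p. - a n p) \<in> I"
    and mult: "\<And>a b. a \<in> I \<Longrightarrow> b \<in> carrier A \<Longrightarrow> b \<otimes>\<^bsub>A\<^esub> a \<in> I \<and> a \<otimes>\<^bsub>A\<^esub> b \<in> I"
  shows "two_sided_ideal I A"
proof -
  have "abelian_group A"
  proof (rule abelian_groupI)
    fix x assume "x \<in> carrier A"
    then show "\<exists>y\<in>carrier A. y \<oplus>\<^bsub>A\<^esub> x = \<zero>\<^bsub>A\<^esub>"
      by (intro bexI [of _ "\<lambda>n p. - x n p"]) (auto simp: neg_closed)
  qed (use sub zero in \<open>auto simp: add_closed algebra_simps\<close>)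
  then interpret abelian_group A .
  have inv: "inv\<^bsub>add_monoid A\<^esub> a = (\<lambda>n p. - a n p)" if "a \<in> carrier A" for a
    using that neg_closed [OF that] unfolding a_inv_def [symmetric]
    by (intro minus_equality) auto
  have "subgroup I (add_monoid A)"
  proof (rule subgroup.intro)
    show "inv\<^bsub>add_monoid A\<^esub> a \<in> I" if "a \<in> I" for a
      using that sub neg inv [of a] by auto
  qed (use sub zero add in auto)
  then show ?thesis
    using mult by (simp add: two_sided_ideal_def additive_subgroup_def)
qed

lemma two_sided_ideal_closed:
  assumes "two_sided_ideal I A"
  shows "I \<subseteq> carrier A" and "(\<lambda>n p. 0) \<in> I"
    and "a \<in> I \<Longrightarrow> b \<in> I \<Longrightarrow> (\<lambda>n p. a n p + b n p) \<in> I"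
    and "a \<in> I \<Longrightarrow> b \<in> carrier A \<Longrightarrow> b \<otimes>\<^bsub>A\<^esub> a \<in> I"
    and "a \<in> I \<Longrightarrow> b \<in> carrier A \<Longrightarrow> a \<otimes>\<^bsub>A\<^esub> b \<in> I"
proof -
  interpret additive_subgroup I A using assms by (simp add: two_sided_ideal_def)
  show "I \<subseteq> carrier A" "(\<lambda>n p. 0) \<in> I" "a \<in> I \<Longrightarrow> b \<in> I \<Longrightarrow> (\<lambda>n p. a n p + b n p) \<in> I"
    using a_subset zero_closed a_closed by auto
qed (use assms in \<open>auto simp: two_sided_ideal_def\<close>)

lemma simple_ideal_eq_carrier:
  assumes "simple_ring A" "two_sided_ideal I A" "a \<in> I" "a n \<noteq> (\<lambda>_. 0)"
  shows "I = carrier A"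
  using assms by (auto simp: simple_ring_def fun_eq_iff)

end

section \<open>Necessity: ideals from degenerate systems\<close>

context category_dynamical_system
begin

text \<open>The morphisms that factor through an object \<open>f\<close> are stable under composition with arbitrary
  morphisms on either side, so the elements supported on them form an ideal.  It contains
  \<open>u\<^sub>f\<close>; if it also contains \<open>u\<^sub>e\<close>, then \<open>e\<close> factors through \<open>f\<close>.\<close>

lemma simple_imp_inverse_connected:
  assumes nonempty: "\<And>e. e \<in> Ob G \<Longrightarrow> topspace (X e) \<noteq> {}"
    and simple: "simple_ring A"
  shows "inverse_connected G"
  unfolding inverse_connected_def
proof (intro ballI)
  fix e f assume e: "e \<in> Ob G" and f: "f \<in> Ob G"
  define F where "F = {m \<cdot> n | m n. m \<in> Mor G \<and> n \<in> Mor G \<and> Dom G m = f \<and> Cod G n = f}"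
  define I where "I = {a \<in> carrier A. support a \<subseteq> F}"
  have left: "k \<cdot> l \<in> F" if kl: "(k, l) \<in> composable G" "l \<in> F" for k l
  proof -
    obtain m n where mn: "l = m \<cdot> n" "m \<in> Mor G" "n \<in> Mor G" "Dom G m = f" "Cod G n = f"
      using kl(2) by (auto simp: F_def)
    have k: "k \<in> Mor G" "Dom G k = Cod G m"
      using kl(1) mn Cod_Comp by (auto simp: composable_def)
    then have "k \<cdot> l = (k \<cdot> m) \<cdot> n" "k \<cdot> m \<in> Mor G" "Dom G (k \<cdot> m) = f"
      using mn Comp_assoc Comp_closed Dom_Comp by auto
    then show ?thesis using mn by (auto simp: F_def)
  qed
  have right: "k \<cdot> l \<in> F" if kl: "(k, l) \<in> composable G" "k \<in> F" for k l
  proof -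
    obtain m n where mn: "k = m \<cdot> n" "m \<in> Mor G" "n \<in> Mor G" "Dom G m = f" "Cod G n = f"
      using kl(2) by (auto simp: F_def)
    have l: "l \<in> Mor G" "Dom G n = Cod G l"
      using kl(1) mn Dom_Comp by (auto simp: composable_def)
    then have "k \<cdot> l = m \<cdot> (n \<cdot> l)" "n \<cdot> l \<in> Mor G" "Cod G (n \<cdot> l) = f"
      using mn Comp_assoc Comp_closed Cod_Comp by auto
    then show ?thesis using mn by (auto simp: F_def)
  qed
  have ideal: "two_sided_ideal I A"
  proof (rule two_sided_idealI)
    fix a b assume a: "a \<in> I" and b: "b \<in> carrier A"
    have "support (b \<otimes>\<^bsub>A\<^esub> a) \<subseteq> F"
      using mult_support [OF b, of a] a left by (auto simp: I_def)
    moreover have "support (a \<otimes>\<^bsub>A\<^esub> b) \<subseteq> F"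
      using mult_support [of a b] a right by (auto simp: I_def)
    ultimately show "b \<otimes>\<^bsub>A\<^esub> a \<in> I \<and> a \<otimes>\<^bsub>A\<^esub> b \<in> I"
      using a b mult_closed by (auto simp: I_def)
  next
    show "(\<lambda>n p. 0) \<in> I"
      by (auto simp: I_def support_def intro!: carrierI [of _ "{}"])
    show "(\<lambda>n p. a n p + b n p) \<in> I" if "a \<in> I" "b \<in> I" for a b
    proof -
      have "support (\<lambda>n p. a n p + b n p) \<subseteq> support a \<union> support b"
        by (auto simp: support_def)
      then show ?thesis using that add_closed [of a b] by (auto simp: I_def)
    qed
    show "(\<lambda>n p. - a n p) \<in> I" if "a \<in> I" for a
    proof -
      have "support (\<lambda>n p. - a n p) = support a" by (auto simp: support_def fun_eq_iff)
      then show ?thesis using that neg_closed [of a] by (auto simp: I_def)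
    qed
  qed (auto simp: I_def)
  have "f \<cdot> f = f" using f Comp_Dom [of f] Ob_subset Dom_Ob [of f] by auto
  then have "f \<in> F"
    using f Ob_subset Dom_Ob [of f] Cod_Ob [of f]
    unfolding F_def by (intro CollectI exI [of _ f]) auto
  then have unit: "monomial f (one_on (X f)) \<in> I"
    using unit_closed [OF f] support_monomial by (fastforce simp: I_def)
  have "I = carrier A"
    using one_on_nonzero [OF nonempty [OF f]]
    by (intro simple_ideal_eq_carrier [OF simple ideal unit, of f]) (simp add: monomial_def)
  then have "support (monomial e (one_on (X e))) \<subseteq> F"
    using unit_closed [OF e] by (auto simp: I_def)
  then have "e \<in> F"
    using one_on_nonzero [OF nonempty [OF e]] by (auto simp: support_def monomial_def)
  then show "\<exists>m\<in>Mor G. \<exists>n\<in>Mor G. Dom G m = f \<and> Cod G n = f \<and> m \<cdot> n = e"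
    by (auto simp: F_def)
qed

text \<open>An invariant closed set \<open>Y\<close> at \<open>e\<close> is transported along all morphisms with codomain \<open>e\<close>
  to a family of sets \<open>Z g\<close> that is stable under every \<open>s m\<close>.  The elements whose coefficients
  vanish on this family form an ideal.  Invariance of \<open>Y\<close> under \<open>G\<^sub>e\<close> gives \<open>Z e = Y\<close>,
  so that the ideal sees whether a function at \<open>e\<close> vanishes on \<open>Y\<close>.\<close>

lemma simple_imp_minimal:
  assumes compact_Hausdorff:
      "\<And>e. e \<in> Ob G \<Longrightarrow> compact_space (X e) \<and> Hausdorff_space (X e)"
    and simple: "simple_ring A"
  shows "minimal G X s"
  unfolding minimal_def
proof (intro ballI notI, elim exE conjE)
  fix e Y
  assume e: "e \<in> Ob G" and Y: "closedin (X e) Y" "Y \<noteq> {}" "Y \<noteq> topspace (X e)"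
    and inv: "\<forall>n\<in>carrier (local_monoid G e). s n ` Y \<subseteq> Y"
  have YX: "Y \<subseteq> topspace (X e)" using Y(1) closedin_subset by blast
  define Z where "Z g = {s n y | n y. n \<in> Mor G \<and> Dom G n = g \<and> Cod G n = e \<and> y \<in> Y}" for g
  have eM: "e \<in> Mor G" "Dom G e = e" "Cod G e = e"
    using e Ob_subset Dom_Ob Cod_Ob by auto
  have Ze: "Z e = Y"
  proof
    show "Z e \<subseteq> Y" using inv by (auto simp: Z_def local_monoid_def)
    have "y \<in> Z e" if "y \<in> Y" for y
    proof -
      have "y = s e y" using that s_Ob [OF e] YX by auto
      then show ?thesis unfolding Z_def using eM that by blast
    qed
    then show "Y \<subseteq> Z e" by blast
  qed
  have Z_inv: "s m q \<in> Z (Dom G m)" if m: "m \<in> Mor G" and q: "q \<in> Z (Cod G m)" for m q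
  proof -
    obtain k y where k: "q = s k y" "k \<in> Mor G" "Dom G k = Cod G m" "Cod G k = e" "y \<in> Y"
      using q by (auto simp: Z_def)
    then have "s m q = s (k \<cdot> m) y"
      using m YX s_Comp [of k m y] by (auto simp: composable_def)
    moreover have "k \<cdot> m \<in> Mor G" "Dom G (k \<cdot> m) = Dom G m" "Cod G (k \<cdot> m) = e"
      using k m Comp_closed Dom_Comp Cod_Comp by auto
    ultimately show ?thesis using k(5) unfolding Z_def by blast
  qed
  define I where "I = {a \<in> carrier A. \<forall>n\<in>Mor G. \<forall>q\<in>Z (Cod G n). a n q = 0}"
  have ideal: "two_sided_ideal I A"
  proof (rule two_sided_idealI)
    fix a b assume a: "a \<in> I" and b: "b \<in> carrier A"
    have aA: "a \<in> carrier A" using a by (simp add: I_def)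
    note fin = support_finite [OF aA] support_finite [OF b]
    have "(b \<otimes>\<^bsub>A\<^esub> a) l q = 0" if l: "l \<in> Mor G" and q: "q \<in> Z (Cod G l)" for l q
    proof -
      have "b m q * a n (s m q) = 0" if "(m, n) \<in> composable G" "m \<cdot> n = l" for m n
      proof -
        have "m \<in> Mor G" "n \<in> Mor G" "Dom G m = Cod G n" "Cod G l = Cod G m"
          using that Cod_Comp by (auto simp: composable_def)
        then show ?thesis using Z_inv [of m q] q a by (simp add: I_def)
      qed
      then show ?thesis
        by (subst mult_apply [OF b fin(2,1) order_refl order_refl]) (simp add: sum.neutral)
    qed
    moreover have "(a \<otimes>\<^bsub>A\<^esub> b) l q = 0" if l: "l \<in> Mor G" and q: "q \<in> Z (Cod G l)" for l q
    proof -
      have "a m q * b n (s m q) = 0" if "(m, n) \<in> composable G" "m \<cdot> n = l" for m n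
      proof -
        have "m \<in> Mor G" "Cod G l = Cod G m"
          using that Cod_Comp by (auto simp: composable_def)
        then show ?thesis using q a by (simp add: I_def)
      qed
      then show ?thesis
        by (subst mult_apply [OF aA fin order_refl order_refl]) (simp add: sum.neutral)
    qed
    ultimately show "b \<otimes>\<^bsub>A\<^esub> a \<in> I \<and> a \<otimes>\<^bsub>A\<^esub> b \<in> I"
      using aA b mult_closed by (auto simp: I_def)
  next
    show "(\<lambda>n p. 0) \<in> I"
      by (auto simp: I_def support_def intro!: carrierI [of _ "{}"])
  qed (auto simp: I_def add_closed neg_closed)
  obtain q where q: "q \<in> topspace (X e)" "q \<notin> Y" using Y(3) YX by auto
  obtain h where h: "h \<in> cont_fun (X e)" "h q = 1" "\<And>p. p \<in> Y \<Longrightarrow> h p = 0"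
    using cont_fun_separates [OF _ _ Y(1) q] compact_Hausdorff [OF e] by blast
  have "monomial e h \<in> I"
    using monomial_closed [OF eM(1), of h] eM h Ze by (auto simp: I_def monomial_def)
  then have "I = carrier A"
    using simple ideal h(2)
    by (intro simple_ideal_eq_carrier [of _ _ e]) (auto simp: monomial_def)
  then have "monomial e (one_on (X e)) \<in> I" using unit_closed [OF e] by simp
  moreover obtain y where y: "y \<in> Y" using Y(2) by blast
  ultimately have "one_on (X e) y = 0" using eM Ze by (auto simp: I_def monomial_def)
  then show False using y YX by (auto simp: one_on_def)
qed

text \<open>The action of the algebra on arbitrary families \<open>\<phi>\<close> of functions, one on each space:
  \<open>a u\<^sub>m\<close> sends \<open>\<phi>\<close> to \<open>a \<cdot> (\<phi>\<^sub>d \<circ> s m)\<close> at the codomain of \<open>m\<close>, where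
  \<open>d\<close> is the domain of \<open>m\<close>.  It knows \<open>m\<close> only through its
  endpoints and \<open>s m\<close>, so its kernel detects failures of faithfulness.\<close>

definition act ::
  "('m \<Rightarrow> 'x \<Rightarrow> complex) \<Rightarrow> ('m \<Rightarrow> 'x \<Rightarrow> complex) \<Rightarrow> 'm \<Rightarrow> 'x \<Rightarrow> complex" where
  "act a \<phi> c p = (\<Sum>m\<in>support a. if Cod G m = c then a m p * \<phi> (Dom G m) (s m p) else 0)"

lemma act_superset:
  assumes "finite S" "support a \<subseteq> S"
  shows "act a \<phi> c p = (\<Sum>m\<in>S. if Cod G m = c then a m p * \<phi> (Dom G m) (s m p) else 0)"
  unfolding act_def using assms by (intro sum.mono_neutral_left) (auto simp: support_def)

lemma act_add:
  assumes "a \<in> carrier A" "b \<in> carrier A"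
  shows "act (\<lambda>n p. a n p + b n p) \<phi> c p = act a \<phi> c p + act b \<phi> c p"
proof -
  define S where "S = support a \<union> support b"
  have S: "finite S" "support a \<subseteq> S" "support b \<subseteq> S" "support (\<lambda>n p. a n p + b n p) \<subseteq> S"
    using assms support_finite by (auto simp: S_def support_def)
  show ?thesis
    unfolding act_superset [OF S(1,2)] act_superset [OF S(1,3)] act_superset [OF S(1,4)]
      sum.distrib [symmetric]
    by (intro sum.cong) (auto simp: algebra_simps)
qed

lemma act_neg: "act (\<lambda>n p. - a n p) \<phi> c p = - act a \<phi> c p"
  by (auto simp: act_def support_def fun_eq_iff sum_negf [symmetric] intro!: sum.cong)

text \<open>Functoriality of \<open>s\<close> is what makes \<open>act\<close> multiplicative.\<close>

lemma act_mult:
  assumes a: "a \<in> carrier A" and b: "b \<in> carrier A"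
  shows "act (a \<otimes>\<^bsub>A\<^esub> b) \<phi> c p = act a (act b \<phi>) c p"
proof -
  define L where "L = (\<lambda>(m, n). m \<cdot> n) ` (support a \<times> support b)"
  note fin = support_finite [OF a] support_finite [OF b]
  have L: "finite L" "support (a \<otimes>\<^bsub>A\<^esub> b) \<subseteq> L"
    using fin mult_support [OF a, of b] by (auto simp: L_def)
  define T where "T m n = (if Cod G m = c \<and> Cod G n = Dom G m
      then a m p * (b n (s m p) * \<phi> (Dom G n) (s n (s m p))) else 0)" for m n
  \<comment> \<open>If \<open>p\<close> is not a point of the space at the codomain of \<open>m\<close>, then \<open>a m p = 0\<close>, so the law
      \<open>s (m \<cdot> n) p = s n (s m p)\<close> is used only where it holds.\<close>
  have term_eq: "(if (m, n) \<in> composable G \<and> m \<cdot> n = l then a m p * b n (s m p) else 0)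
      * (if Cod G l = c then \<phi> (Dom G l) (s l p) else 0) = (if l = m \<cdot> n then T m n else 0)"
    if m: "m \<in> support a" and n: "n \<in> support b" for l m n
  proof (cases "l = m \<cdot> n \<and> Dom G m = Cod G n")
    case True
    have "m \<in> Mor G" "n \<in> Mor G" using m n support_Mor a b by auto
    then have mn: "(m, n) \<in> composable G" "Dom G l = Dom G n" "Cod G l = Cod G m"
      using True Dom_Comp Cod_Comp by (auto simp: composable_def)
    show ?thesis
    proof (cases "p \<in> topspace (X (Cod G m))")
      case p: True
      then show ?thesis using True mn s_Comp [OF mn(1) p] by (auto simp: T_def)
    next
      case False
      then show ?thesis using coeff_outside_space [OF a False] by (auto simp: T_def)
    qed
  qed (auto simp: T_def composable_def)
  have "act (a \<otimes>\<^bsub>A\<^esub> b) \<phi> c p =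
      (\<Sum>l\<in>L. (a \<otimes>\<^bsub>A\<^esub> b) l p * (if Cod G l = c then \<phi> (Dom G l) (s l p) else 0))"
    unfolding act_superset [OF L] by (intro sum.cong) auto
  also have "\<dots> = (\<Sum>l\<in>L. \<Sum>m\<in>support a. \<Sum>n\<in>support b. if l = m \<cdot> n then T m n else 0)"
    by (subst mult_apply [OF a fin order_refl order_refl], unfold sum_distrib_right,
        intro sum.cong refl term_eq)
  also have "\<dots> = (\<Sum>m\<in>support a. \<Sum>n\<in>support b. \<Sum>l\<in>L. if l = m \<cdot> n then T m n else 0)"
    by (rule trans [OF sum.swap], rule sum.cong [OF refl], rule sum.swap)
  also have "\<dots> = (\<Sum>m\<in>support a. \<Sum>n\<in>support b. T m n)"
    using L(1) by (intro sum.cong refl) (auto simp: L_def)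
  also have "\<dots> = act a (act b \<phi>) c p"
    unfolding act_def by (intro sum.cong refl) (auto simp: T_def sum_distrib_left intro!: sum.cong)
  finally show ?thesis .
qed

text \<open>If a nonidentity \<open>n \<in> G\<^sub>e\<close> acts trivially, then \<open>u\<^sub>e - u\<^sub>n\<close> is a nonzero element of
  the kernel of \<open>act\<close>.  That kernel is an ideal, and it does not contain \<open>u\<^sub>e\<close>.\<close>

lemma simple_imp_faithful:
  assumes nonempty: "\<And>e. e \<in> Ob G \<Longrightarrow> topspace (X e) \<noteq> {}"
    and simple: "simple_ring A"
  shows "faithful G X s"
  unfolding faithful_def
proof (intro ballI impI, rule ccontr)
  fix e n
  assume e: "e \<in> Ob G" and n: "n \<in> carrier (local_monoid G e)" "n \<noteq> e"
    and "\<not> (\<exists>p\<in>topspace (X e). s n p \<noteq> p)"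
  then have triv: "s n p = p" if "p \<in> topspace (X e)" for p using that by blast
  define I where "I = {a \<in> carrier A. \<forall>\<phi> c. \<forall>p\<in>topspace (X c). act a \<phi> c p = 0}"
  have act0: "act b \<psi> c p = 0"
    if b: "b \<in> carrier A" and p: "p \<in> topspace (X c)"
      and "\<And>d q. q \<in> topspace (X d) \<Longrightarrow> \<psi> d q = 0" for b \<psi> c p
    unfolding act_def
  proof (intro sum.neutral ballI)
    fix m assume "m \<in> support b"
    then have "m \<in> Mor G" using support_Mor b by auto
    then show "(if Cod G m = c then b m p * \<psi> (Dom G m) (s m p) else 0) = 0"
      using s_closed [of m p] that(3) p by auto
  qed
  have ideal: "two_sided_ideal I A"
  proof (rule two_sided_idealI)
    show "b \<otimes>\<^bsub>A\<^esub> a \<in> I \<and> a \<otimes>\<^bsub>A\<^esub> b \<in> I" if "a \<in> I" "b \<in> carrier A" for a b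
    proof -
      have a: "a \<in> carrier A" "act a \<phi> c p = 0" if "p \<in> topspace (X c)" for \<phi> c p
        using \<open>a \<in> I\<close> that by (auto simp: I_def)
      have "act b (act a \<phi>) c p = 0" if "p \<in> topspace (X c)" for \<phi> c p
        using act0 \<open>b \<in> carrier A\<close> that a(2) by blast
      then show ?thesis using that by (simp add: I_def mult_closed act_mult)
    qed
    show "(\<lambda>n p. 0) \<in> I"
      by (auto simp: I_def support_def act_def intro!: carrierI [of _ "{}"])
  qed (auto simp: I_def add_closed neg_closed act_add act_neg)
  have eM: "e \<in> Mor G" "Dom G e = e" "Cod G e = e"
    using e Ob_subset Dom_Ob Cod_Ob by auto
  have nM: "n \<in> Mor G" "Dom G n = e" "Cod G n = e"
    using n by (auto simp: local_monoid_def)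
  have act_monomial: "act (monomial m (one_on (X e))) \<phi> c p =
      (if e = c \<and> p \<in> topspace (X e) then \<phi> (Dom G m) (s m p) else 0)"
    if "Cod G m = e" for m \<phi> c p
    using that act_superset [OF _ support_monomial, of m "one_on (X e)" \<phi> c p]
    by (simp add: monomial_def one_on_def)
  define d where "d = (\<lambda>l p. monomial e (one_on (X e)) l p
    + (\<lambda>l p. - monomial n (one_on (X e)) l p) l p)"
  have closed: "monomial n (one_on (X e)) \<in> carrier A"
    using nM by (intro monomial_closed) (auto simp: one_on_cont_fun)
  have "d \<in> carrier A"
    unfolding d_def by (intro add_closed neg_closed unit_closed closed e)
  moreover have "act d \<phi> c p = 0" for \<phi> c p
  proof -
    have "act d \<phi> c p = act (monomial e (one_on (X e))) \<phi> c p
        + act (\<lambda>l p. - monomial n (one_on (X e)) l p) \<phi> c p"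
      unfolding d_def by (rule act_add [OF unit_closed [OF e] neg_closed [OF closed]])
    then show ?thesis
      using s_Ob [OF e, of p] triv [of p] eM(2) nM(2)
      by (auto simp: act_neg act_monomial [OF eM(3)] act_monomial [OF nM(3)])
  qed
  ultimately have "d \<in> I" by (simp add: I_def)
  moreover have "d e \<noteq> (\<lambda>_. 0)"
    using n(2) one_on_nonzero [OF nonempty [OF e]] by (auto simp: d_def monomial_def)
  ultimately have "I = carrier A"
    using simple ideal by (intro simple_ideal_eq_carrier)
  then have "monomial e (one_on (X e)) \<in> I" using unit_closed [OF e] by simp
  moreover obtain p where "p \<in> topspace (X e)" using nonempty [OF e] by blast
  \<comment> \<open>But \<open>u\<^sub>e\<close> reproduces the constant family \<open>1\<close> at \<open>e\<close>.\<close>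
  ultimately have "act (monomial e (one_on (X e))) (\<lambda>_ _. 1) e p = 0" by (simp add: I_def)
  then show False using \<open>p \<in> topspace (X e)\<close> by (simp add: act_monomial eM)
qed

end

section \<open>Sufficiency for groupoids\<close>

context category_dynamical_system
begin

lemma groupoid_inverse:
  assumes "groupoid G" "n \<in> Mor G"
  obtains k where "k \<in> Mor G" "Dom G k = Cod G n" "Cod G k = Dom G n"
    "n \<cdot> k = Cod G n" "k \<cdot> n = Dom G n"
  using assms unfolding groupoid_def by blast

text \<open>Multiplying by \<open>u\<^sub>e\<close> on the left and by the inverse of \<open>u\<^sub>n\<close> on the right, where \<open>e\<close> is the
  codomain of \<open>n\<close>, moves the coefficient at \<open>n\<close> to the identity \<open>e\<close> and discards everything
  outside \<open>G\<^sub>e\<close>.\<close>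

lemma ideal_localize:
  assumes "groupoid G" and I: "two_sided_ideal I A" and a: "a \<in> I" and n: "n \<in> Mor G"
  shows "(\<lambda>l. if l \<in> carrier (local_monoid G (Cod G n)) then a (l \<cdot> n) else (\<lambda>_. 0)) \<in> I"
proof -
  obtain k where k: "k \<in> Mor G" "Dom G k = Cod G n" "Cod G k = Dom G n"
      "n \<cdot> k = Cod G n" "k \<cdot> n = Dom G n"
    using groupoid_inverse assms by blast
  define e where "e = Cod G n"
  have e: "e \<in> Ob G" using n Cod_closed by (simp add: e_def)
  have aA: "a \<in> carrier A" using a I two_sided_ideal_closed(1) by blast
  define b where "b = a \<otimes>\<^bsub>A\<^esub> monomial k (one_on (X (Dom G n)))"
  have bI: "b \<in> I"
    unfolding b_def using k one_on_cont_fun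
    by (intro two_sided_ideal_closed(5) [OF I a] monomial_closed) (auto simp: k(3))
  then have bA: "b \<in> carrier A" using I two_sided_ideal_closed(1) by blast
  have "(monomial e (one_on (X e)) \<otimes>\<^bsub>A\<^esub> b) l p =
    (if l \<in> carrier (local_monoid G e) then a (l \<cdot> n) p else 0)" for l p
  proof -
    have "(monomial e (one_on (X e)) \<otimes>\<^bsub>A\<^esub> b) l p = (if l \<in> carrier (local_monoid G e)
      then one_on (X e) p * (a (l \<cdot> n) p * one_on (X (Dom G n)) (s (l \<cdot> n) p)) else 0)"
      unfolding mult_object_left [OF e one_on_cont_fun bA] unfolding b_def
      using k n by (subst mult_iso_right [OF k(1) n _ _ _ _ aA]) (auto simp: local_monoid_def e_def)
    moreover have "one_on (X e) p * (a (l \<cdot> n) p * one_on (X (Dom G n)) (s (l \<cdot> n) p)) = a (l \<cdot> n) p"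
      if "l \<in> carrier (local_monoid G e)"
    proof -
      have ln: "l \<cdot> n \<in> Mor G" "Dom G (l \<cdot> n) = Dom G n" "Cod G (l \<cdot> n) = e"
        using that n Comp_closed Dom_Comp Cod_Comp by (auto simp: local_monoid_def e_def)
      show ?thesis
        using s_closed [OF ln(1), of p] coeff_outside_space [OF aA, of p "l \<cdot> n"] ln
        by (auto simp: one_on_def)
    qed
    ultimately show ?thesis by auto
  qed
  then have "monomial e (one_on (X e)) \<otimes>\<^bsub>A\<^esub> b =
      (\<lambda>l. if l \<in> carrier (local_monoid G e) then a (l \<cdot> n) else (\<lambda>_. 0))"
    by (auto simp: fun_eq_iff)
  moreover have "monomial e (one_on (X e)) \<otimes>\<^bsub>A\<^esub> b \<in> I"
    using two_sided_ideal_closed(4) [OF I bI unit_closed [OF e]] .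
  ultimately show ?thesis by (simp add: e_def)
qed

text \<open>Take \<open>a\<close> of smallest support among the elements of \<open>I\<close> supported on \<open>G\<^sub>e\<close> with nonzero
  coefficient at \<open>e\<close>.  For a function \<open>f\<close> on \<open>X e\<close>, the commutator of \<open>f u\<^sub>e\<close> with \<open>a\<close> has
  coefficients \<open>(f - f \<circ> s n) \<cdot> a n\<close>.  Thus it loses the coefficient at \<open>e\<close>, and localizing it at
  a nonzero coefficient would contradict the choice of \<open>a\<close>.  So all commutators vanish, which by
  Urysohn's lemma means that \<open>s n\<close> fixes each point where \<open>a n\<close> is nonzero.\<close>

lemma ideal_element_fixing_its_support:
  assumes gpd: "groupoid G"
    and compact_Hausdorff: "\<And>e. e \<in> Ob G \<Longrightarrow> compact_space (X e) \<and> Hausdorff_space (X e)"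
    and I: "two_sided_ideal I A" and a0: "a\<^sub>0 \<in> I" "a\<^sub>0 n\<^sub>0 \<noteq> (\<lambda>_. 0)"
  obtains a e where "e \<in> Ob G" "a \<in> I" "support a \<subseteq> carrier (local_monoid G e)" "a e \<noteq> (\<lambda>_. 0)"
    "\<forall>n p. a n p \<noteq> 0 \<longrightarrow> s n p = p"
proof -
  have IA: "I \<subseteq> carrier A" using I two_sided_ideal_closed(1) by blast
  define e where "e = Cod G n\<^sub>0"
  define L where "L = carrier (local_monoid G e)"
  have n0: "n\<^sub>0 \<in> Mor G" using a0 IA coeff_outside_Mor by blast
  have e: "e \<in> Ob G" using n0 Cod_closed by (simp add: e_def)
  then have eM: "e \<in> Mor G" "Dom G e = e" "Cod G e = e"
    using Ob_subset Dom_Ob Cod_Ob by auto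
  have L: "l \<in> L \<longleftrightarrow> l \<in> Mor G \<and> Dom G l = e \<and> Cod G l = e" for l
    by (auto simp: L_def local_monoid_def)
  define P where "P a \<longleftrightarrow> a \<in> I \<and> support a \<subseteq> L \<and> a e \<noteq> (\<lambda>_. 0)" for a
  have localized: "P (\<lambda>l. if l \<in> L then a (l \<cdot> n) else (\<lambda>_. 0))"
    if "a \<in> I" "n \<in> Mor G" "Cod G n = e" "a n \<noteq> (\<lambda>_. 0)" for a n
    using ideal_localize [OF gpd I that(1,2)] that(3,4) Cod_Comp_left [OF that(2)] eM
    unfolding P_def by (auto simp: support_def L L_def [symmetric])
  have "\<exists>a. P a" using localized [OF a0(1) n0 _ a0(2)] e_def by blast
  then obtain a where a: "P a" and least: "\<And>b. P b \<Longrightarrow> card (support a) \<le> card (support b)"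
    using ex_has_least_nat [of P _ "\<lambda>a. card (support a)"] by blast
  then have aI: "a \<in> I" and aL: "support a \<subseteq> L" and ae: "a e \<noteq> (\<lambda>_. 0)" by (auto simp: P_def)
  have aA: "a \<in> carrier A" using aI IA by blast
  have "s n p = p" if anp: "a n p \<noteq> 0" for n p
  proof (rule ccontr)
    assume moved: "s n p \<noteq> p"
    have nL: "n \<in> L" using anp aL by (auto simp: support_def)
    then have n: "n \<in> Mor G" "Dom G n = e" "Cod G n = e" using L by auto
    have p: "p \<in> topspace (X e)" using coeff_outside_space [OF aA, of p n] anp n by auto
    have np: "s n p \<in> topspace (X e)" using s_closed [OF n(1), of p] p n by simp
    have "closedin (X e) {s n p}"
      using np compact_Hausdorff [OF e] by (simp add: closedin_Hausdorff_singleton)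
    moreover have "p \<notin> {s n p}" using moved by simp
    ultimately obtain f where "f \<in> cont_fun (X e)" "f p = 1" "\<And>q. q \<in> {s n p} \<Longrightarrow> f q = 0"
      using cont_fun_separates [OF _ _ _ p] compact_Hausdorff [OF e] by blast
    then have f: "f \<in> cont_fun (X e)" "f p = 1" "f (s n p) = 0" by auto
    \<comment> \<open>The commutator of \<open>f u\<^sub>e\<close> and \<open>a\<close>, with the sign moved into the second factor.\<close>
    define c where "c = (\<lambda>l q. (monomial e f \<otimes>\<^bsub>A\<^esub> a) l q
      + (a \<otimes>\<^bsub>A\<^esub> monomial e (\<lambda>q. - f q)) l q)"
    have mon: "monomial e f \<in> carrier A" "monomial e (\<lambda>q. - f q) \<in> carrier A"
      using f(1) eM cont_fun_uminus by (auto intro!: monomial_closed)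
    have cI: "c \<in> I"
      unfolding c_def using mon by (intro two_sided_ideal_closed(3-5) [OF I] aI)
    have c: "c l q = (f q - f (s l q)) * a l q" for l q
    proof (cases "l \<in> L")
      case True
      then show ?thesis
        unfolding c_def mult_object_left [OF e f(1) aA] mult_object_right [OF e aA]
        by (simp add: L algebra_simps)
    next
      case False
        then have "l \<notin> support a" using aL by blast
      then have "a l q = 0" by (simp add: support_def)
      then show ?thesis
        unfolding c_def mult_object_left [OF e f(1) aA] mult_object_right [OF e aA] by simp
    qed
    have "c e q = 0" for q
      using s_Ob [OF e, of q] coeff_outside_space [OF aA, of q e] eM
      by (cases "q \<in> topspace (X e)") (simp_all add: c)
    then have ce: "support c \<subseteq> support a - {e}" by (auto simp: support_def c)
    have "c n p \<noteq> 0" using anp f by (simp add: c)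
    then have cn: "c n \<noteq> (\<lambda>_. 0)" by auto
    define c' where "c' = (\<lambda>l. if l \<in> L then c (l \<cdot> n) else (\<lambda>_. 0))"
    have Pc': "P c'" unfolding c'_def using localized [OF cI n(1,3) cn] .
    obtain k where k: "k \<in> Mor G" "Dom G k = Cod G n" "Cod G k = Dom G n" "n \<cdot> k = Cod G n"
      using groupoid_inverse [OF gpd n(1)] by blast
    have cancel: "(l \<cdot> n) \<cdot> k = l" if "l \<in> L" for l
      using that k n Comp_assoc [of l n k] Comp_Dom [of l] by (auto simp: L)
    \<comment> \<open>Translation by \<open>n\<close> embeds the support of \<open>c'\<close> into that of \<open>c\<close>, which misses \<open>e\<close>.\<close>
    have "inj_on (\<lambda>l. l \<cdot> n) (support c')"
      using Pc' cancel unfolding P_def by (intro inj_onI) (metis subsetD)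
    moreover have "(\<lambda>l. l \<cdot> n) ` support c' \<subseteq> support c"
      by (auto simp: support_def c'_def)
    moreover have "finite (support a)" using support_finite aA by blast
    ultimately have "card (support c') \<le> card (support a - {e})"
      using ce card_inj_on_le [of "\<lambda>l. l \<cdot> n" "support c'" "support a - {e}"] by blast
    also have "\<dots> < card (support a)"
      using ae \<open>finite (support a)\<close> by (intro card_Diff1_less) (auto simp: support_def)
    finally show False using least [OF Pc'] by simp
  qed
  then show thesis using that e aI aL ae unfolding L_def by blast
qed

text \<open>In an element as provided by the preceding lemma, the fixed point set of \<open>s n\<close> is nonempty for
  each \<open>n\<close> in the support.  It is closed, and it is invariant since \<open>G\<^sub>e\<close> is abelian.  By
  minimality \<open>s n\<close> is the identity, and faithfulness leaves only \<open>n = e\<close>.\<close>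

lemma ideal_contains_function:
  assumes gpd: "groupoid G"
    and compact_Hausdorff: "\<And>e. e \<in> Ob G \<Longrightarrow> compact_space (X e) \<and> Hausdorff_space (X e)"
    and abelian: "locally_abelian G" and min: "minimal G X s" and faith: "faithful G X s"
    and I: "two_sided_ideal I A" and a0: "a\<^sub>0 \<in> I" "a\<^sub>0 n\<^sub>0 \<noteq> (\<lambda>_. 0)"
  obtains e f where "e \<in> Ob G" "monomial e f \<in> I" "f \<noteq> (\<lambda>_. 0)"
proof -
  obtain a e where e: "e \<in> Ob G" and a: "a \<in> I" "support a \<subseteq> carrier (local_monoid G e)"
      "a e \<noteq> (\<lambda>_. 0)" and fixed: "\<forall>n p. a n p \<noteq> 0 \<longrightarrow> s n p = p"
    using ideal_element_fixing_its_support [OF gpd compact_Hausdorff I a0] by metis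
  have aA: "a \<in> carrier A" using a I two_sided_ideal_closed(1) by blast
  have "n = e" if nS: "n \<in> support a" for n
  proof -
    have nL: "n \<in> carrier (local_monoid G e)" using nS a by blast
    then have n: "n \<in> Mor G" "Dom G n = e" "Cod G n = e" by (auto simp: local_monoid_def)
    define Y where "Y = {p \<in> topspace (X e). s n p = p}"
    have "continuous_map (X e) (X e) (s n)" using continuous [OF n(1)] n by simp
    then have "closedin (X e) {p \<in> topspace (X e). s n p = (\<lambda>p. p) p}"
      using compact_Hausdorff [OF e] continuous_map_id [of "X e"]
      by (intro closedin_continuous_maps_eq) (auto simp: id_def)
    then have closed: "closedin (X e) Y" by (simp add: Y_def)
    obtain p where "a n p \<noteq> 0" using nS by (auto simp: support_def)
    then have "p \<in> Y" using fixed coeff_outside_space [OF aA, of p n] n by (auto simp: Y_def)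
    moreover have "s m ` Y \<subseteq> Y" if mL: "m \<in> carrier (local_monoid G e)" for m
    proof
      fix q assume "q \<in> s m ` Y"
      then obtain p where p: "p \<in> topspace (X e)" "s n p = p" "q = s m p" by (auto simp: Y_def)
      have m: "m \<in> Mor G" "Dom G m = e" "Cod G m = e" using mL by (auto simp: local_monoid_def)
      interpret comm_monoid "local_monoid G e" using abelian e by (simp add: locally_abelian_def)
      have comm: "m \<cdot> n = n \<cdot> m" using m_comm [OF mL nL] by (simp add: local_monoid_def)
      have "s n (s m p) = s (m \<cdot> n) p"
        using s_Comp [of m n p] m n p by (simp add: composable_def)
      also have "\<dots> = s m (s n p)"
        unfolding comm using s_Comp [of n m p] m n p by (simp add: composable_def)
      finally show "q \<in> Y" using p s_closed [OF m(1), of p] m by (simp add: Y_def)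
    qed
    ultimately have "Y = topspace (X e)" using min e closed unfolding minimal_def by blast
    then have "\<forall>p\<in>topspace (X e). s n p = p" by (auto simp: Y_def)
    then show "n = e" using faith e nL unfolding faithful_def by blast
  qed
  then have "a n = (\<lambda>_. 0)" if "n \<noteq> e" for n using that by (auto simp: support_def)
  then have "a = monomial e (a e)" by (auto simp: monomial_def fun_eq_iff)
  then show thesis using that [OF e, of "a e"] a by simp
qed

text \<open>The functions \<open>f\<close> with \<open>f u\<^sub>e \<in> I\<close> form an ideal of \<open>C(e)\<close> that is stable under \<open>G\<^sub>e\<close>
  through conjugation by the \<open>u\<^sub>n\<close>, so their common zeros form an invariant closed set.  By
  minimality this set is empty, and compactness produces the unit.\<close>

lemma ideal_contains_unit:
  assumes gpd: "groupoid G" and compact: "compact_space (X e)" and min: "minimal G X s"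
    and I: "two_sided_ideal I A" and e: "e \<in> Ob G"
    and f0: "monomial e f\<^sub>0 \<in> I" "f\<^sub>0 \<noteq> (\<lambda>_. 0)"
  shows "monomial e (one_on (X e)) \<in> I"
proof -
  have eM: "e \<in> Mor G" "Dom G e = e" "Cod G e = e"
    using e Ob_subset Dom_Ob Cod_Ob by auto
  have IA: "I \<subseteq> carrier A" using I two_sided_ideal_closed(1) by blast
  define J where "J = {f. monomial e f \<in> I}"
  have J_cont: "J \<subseteq> cont_fun (X e)"
    using IA coeff_cont [OF _ eM(1)] eM(3) by (fastforce simp: J_def monomial_def)
  have zero: "(\<lambda>_. 0) \<in> J"
    using two_sided_ideal_closed(2) [OF I] by (simp add: J_def monomial_def)
  have add: "(\<lambda>p. f p + g p) \<in> J" if "f \<in> J" "g \<in> J" for f g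
  proof -
    have "monomial e (\<lambda>p. f p + g p) = (\<lambda>n p. monomial e f n p + monomial e g n p)"
      by (auto simp: monomial_def fun_eq_iff)
    then show ?thesis using that two_sided_ideal_closed(3) [OF I] by (simp add: J_def)
  qed
  have mult: "(\<lambda>p. g p * f p) \<in> J" if "f \<in> J" "g \<in> cont_fun (X e)" for f g
  proof -
    have f: "monomial e f \<in> I" using that by (simp add: J_def)
    have "monomial e (\<lambda>p. g p * f p) = monomial e g \<otimes>\<^bsub>A\<^esub> monomial e f"
      using mult_object_left [OF e that(2), of "monomial e f"] f IA eM
      by (auto simp: monomial_def fun_eq_iff subset_iff)
    then show ?thesis
      using two_sided_ideal_closed(4) [OF I f] monomial_closed [OF eM(1), of g] that(2) eM
      by (simp add: J_def)
  qed
  define Y where "Y = {p \<in> topspace (X e). \<forall>f\<in>J. f p = 0}"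
  have "closedin (X e) {p \<in> topspace (X e). f p \<in> {0}}" if "f \<in> J" for f
    using that J_cont
    by (intro closedin_continuous_map_preimage [of _ euclidean]) (auto simp: cont_fun_def)
  then have "closedin (X e) (\<Inter>f\<in>J. {p \<in> topspace (X e). f p \<in> {0}})"
    using zero by (intro closedin_INT) auto
  moreover have "(\<Inter>f\<in>J. {p \<in> topspace (X e). f p \<in> {0}}) = Y"
    using zero by (auto simp: Y_def)
  ultimately have closed: "closedin (X e) Y" by simp
  have "s n ` Y \<subseteq> Y" if nL: "n \<in> carrier (local_monoid G e)" for n
  proof
    fix q assume "q \<in> s n ` Y"
    then obtain p where p: "p \<in> topspace (X e)" "\<And>f. f \<in> J \<Longrightarrow> f p = 0" and q: "q = s n p"
      by (auto simp: Y_def)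
    have n: "n \<in> Mor G" "Dom G n = e" "Cod G n = e" using nL by (auto simp: local_monoid_def)
    have np: "s n p \<in> topspace (X e)" using s_closed [OF n(1), of p] p n by simp
    obtain k where k: "k \<in> Mor G" "Dom G k = e" "Cod G k = e" "n \<cdot> k = e"
      using groupoid_inverse [OF gpd n(1)] n by metis
    have "f (s n p) = 0" if fJ: "f \<in> J" for f
    proof -
      have f: "monomial e f \<in> I" "f \<in> cont_fun (X e)" using fJ J_cont by (auto simp: J_def)
      have ek: "e \<cdot> k = k" using Cod_Comp_left [OF k(1)] k by simp
      have "monomial e f \<otimes>\<^bsub>A\<^esub> monomial k (one_on (X e)) =
          monomial k (\<lambda>p. f p * one_on (X e) (s e p))"
        using mult_monomial [of e k f "one_on (X e)"] eM k f ek by simp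
      moreover have "monomial n (one_on (X e)) \<otimes>\<^bsub>A\<^esub> monomial k (\<lambda>p. f p * one_on (X e) (s e p)) =
          monomial e (\<lambda>p. one_on (X e) p * (f (s n p) * one_on (X e) (s e (s n p))))"
        using mult_monomial [of n k "one_on (X e)"] n k by (simp add: one_on_cont_fun)
      moreover have "monomial n (one_on (X e)) \<otimes>\<^bsub>A\<^esub>
          (monomial e f \<otimes>\<^bsub>A\<^esub> monomial k (one_on (X e))) \<in> I"
        using n k by (intro two_sided_ideal_closed(4,5) [OF I] f monomial_closed)
          (auto simp: one_on_cont_fun)
      ultimately have "(\<lambda>p. one_on (X e) p * (f (s n p) * one_on (X e) (s e (s n p)))) \<in> J"
        by (simp add: J_def)
      \<comment> \<open>Conjugating \<open>f u\<^sub>e\<close> by \<open>u\<^sub>n\<close> gave \<open>f \<circ> s n\<close>, which vanishes at \<open>p\<close>.\<close>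
      from p(2) [OF this] show ?thesis
        using p(1) np s_Ob [OF e np] by (simp add: one_on_def)
    qed
    then show "q \<in> Y" using np by (simp add: Y_def q)
  qed
  moreover have "Y \<noteq> topspace (X e)"
  proof -
    obtain p where p: "f\<^sub>0 p \<noteq> 0" using f0(2) by auto
    have J: "f\<^sub>0 \<in> J" using f0 by (simp add: J_def)
    then have "p \<in> topspace (X e)"
      using p J_cont cont_fun_outside [of f\<^sub>0 "X e" p] by blast
    moreover have "p \<notin> Y" using p J by (auto simp: Y_def)
    ultimately show ?thesis by blast
  qed
  ultimately have "Y = {}" using min e closed unfolding minimal_def by blast
  then have "one_on (X e) \<in> J"
    using compact J_cont zero add mult
    by (intro ideal_of_cont_fun_without_common_zero) (auto simp: Y_def)
  then show ?thesis by (simp add: J_def)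
qed

text \<open>Connectedness lets every morphism \<open>n\<close> be factored as \<open>m \<cdot> e \<cdot> (m\<^sup>-\<^sup>1 \<cdot> n)\<close> through \<open>e\<close>, hence
  every monomial is a multiple of \<open>u\<^sub>e\<close>.\<close>

lemma ideal_eq_carrier_if_unit:
  assumes gpd: "groupoid G" and conn: "inverse_connected G"
    and I: "two_sided_ideal I A" and e: "e \<in> Ob G" and unit: "monomial e (one_on (X e)) \<in> I"
  shows "I = carrier A"
proof
  show "I \<subseteq> carrier A" using I two_sided_ideal_closed(1) by blast
  have eM: "e \<in> Mor G" "Dom G e = e" "Cod G e = e"
    using e Ob_subset Dom_Ob Cod_Ob by auto
  have monomials: "monomial n g \<in> I" if n: "n \<in> Mor G" and g: "g \<in> cont_fun (X (Cod G n))" for n g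
  proof -
    obtain m m' where m: "m \<in> Mor G" "m' \<in> Mor G" "Dom G m = e" "Cod G m' = e" "m \<cdot> m' = Cod G n"
      using conn e Cod_closed [OF n] unfolding inverse_connected_def by blast
    have cm: "Cod G m = Cod G n"
      using Cod_Comp [of m m'] m Cod_Ob [OF Cod_closed [OF n]] by simp
    obtain k where k: "k \<in> Mor G" "Dom G k = Cod G n" "Cod G k = e" "m \<cdot> k = Cod G n"
      using groupoid_inverse [OF gpd m(1)] m cm by metis
    have kn: "k \<cdot> n \<in> Mor G" "Cod G (k \<cdot> n) = e"
      using k n Comp_closed Cod_Comp by auto
    have ekn: "e \<cdot> (k \<cdot> n) = k \<cdot> n" using Cod_Comp_left [OF kn(1)] kn by simp
    have mkn: "m \<cdot> (k \<cdot> n) = n"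
      using Comp_assoc [of m k n] m k n Cod_Comp_left [OF n] by simp
    define b where "b = monomial e (one_on (X e)) \<otimes>\<^bsub>A\<^esub> monomial (k \<cdot> n) (one_on (X e))"
    have b: "b = monomial (k \<cdot> n) (\<lambda>p. one_on (X e) p * one_on (X e) (s e p))"
      using mult_monomial [of e "k \<cdot> n" "one_on (X e)" "one_on (X e)"] eM kn ekn
      by (simp add: b_def one_on_cont_fun)
    have "monomial m g \<otimes>\<^bsub>A\<^esub> b =
        monomial n (\<lambda>p. g p * (one_on (X e) (s m p) * one_on (X e) (s e (s m p))))"
      unfolding b using mult_monomial [of m "k \<cdot> n" g] m kn mkn g cm by simp
    also have "(\<lambda>p. g p * (one_on (X e) (s m p) * one_on (X e) (s e (s m p)))) = g"
    proof
      fix p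
      show "g p * (one_on (X e) (s m p) * one_on (X e) (s e (s m p))) = g p"
        using cont_fun_outside [OF g, of p] s_closed [OF m(1), of p] s_Ob [OF e, of "s m p"] cm m
        by (cases "p \<in> topspace (X (Cod G n))") (auto simp: one_on_def)
    qed
    finally have "monomial n g = monomial m g \<otimes>\<^bsub>A\<^esub> b" by simp
    moreover have "b \<in> I"
      unfolding b_def using kn
      by (intro two_sided_ideal_closed(5) [OF I] unit monomial_closed) (auto simp: one_on_cont_fun)
    ultimately show ?thesis
      using two_sided_ideal_closed(4) [OF I _ monomial_closed [OF m(1), of g]] g cm by simp
  qed
  have "a \<in> I" if "finite S" "a \<in> carrier A" "support a \<subseteq> S" for a S
    using that
  proof (induction S arbitrary: a rule: finite_induct)
    case empty
    then have "a = (\<lambda>n p. 0)" by (auto simp: support_def fun_eq_iff)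
    then show ?case using two_sided_ideal_closed(2) [OF I] by simp
  next
    case (insert n S)
    define b where "b = a(n := (\<lambda>_. 0))"
    have b: "b \<in> carrier A"
      using insert.prems(1) support_finite [OF insert.prems(1)] coeff_cont coeff_outside_Mor
      by (intro carrierI [of _ "support a"]) (auto simp: b_def support_def)
    moreover have "support b \<subseteq> S" using insert.prems(2) by (auto simp: b_def support_def)
    ultimately have bI: "b \<in> I" using insert.IH by blast
    show ?case
    proof (cases "n \<in> Mor G")
      case True
      then have "monomial n (a n) \<in> I" using monomials coeff_cont [OF insert.prems(1)] by blast
      then have "(\<lambda>l p. b l p + monomial n (a n) l p) \<in> I"
        using two_sided_ideal_closed(3) [OF I bI] by blast
      also have "(\<lambda>l p. b l p + monomial n (a n) l p) = a"
        by (auto simp: b_def monomial_def fun_eq_iff)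
      finally show ?thesis .
    next
      case False
      then have "b = a" using coeff_outside_Mor [OF insert.prems(1)] by (auto simp: b_def)
      then show ?thesis using bI by simp
    qed
  qed
  then show "carrier A \<subseteq> I" using support_finite by blast
qed

lemma simple_if_minimal_faithful:
  assumes gpd: "groupoid G"
    and compact_Hausdorff: "\<And>e. e \<in> Ob G \<Longrightarrow> compact_space (X e) \<and> Hausdorff_space (X e)"
    and abelian: "locally_abelian G" and conn: "inverse_connected G"
    and min: "minimal G X s" and faith: "faithful G X s"
  shows "simple_ring A"
  unfolding simple_ring_def
proof (intro notI, elim exE conjE)
  fix I assume I: "two_sided_ideal I A" "I \<noteq> {\<zero>\<^bsub>A\<^esub>}" "I \<noteq> carrier A"
  obtain a where a: "a \<in> I" "a \<noteq> (\<lambda>n p. 0)"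
    using I(2) two_sided_ideal_closed(2) [OF I(1)] by auto
  then obtain n where "a n \<noteq> (\<lambda>_. 0)" by auto
  then obtain e f where e: "e \<in> Ob G" and "monomial e f \<in> I" "f \<noteq> (\<lambda>_. 0)"
    using ideal_contains_function [OF gpd compact_Hausdorff abelian min faith I(1) a(1)] by blast
  then have "monomial e (one_on (X e)) \<in> I"
    using ideal_contains_unit [OF gpd _ min I(1)] compact_Hausdorff by blast
  then show False using ideal_eq_carrier_if_unit [OF gpd conn I(1) e] I(3) by blast
qed

text \<open>If a nonidentity element of \<open>G\<^sub>e \<cong> \<int>\<close> acts trivially, the action factors through a finite
  group.  Orbits are then finite, hence closed, and a minimal action has only the orbit \<open>X e\<close>,
  which is infinite.\<close>

lemma faithful_if_infinite_cyclic:
  assumes Hausdorff: "\<And>e. e \<in> Ob G \<Longrightarrow> Hausdorff_space (X e)"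
    and infinite: "\<And>e. e \<in> Ob G \<Longrightarrow> infinite (topspace (X e))"
    and cyclic: "\<And>e. e \<in> Ob G \<Longrightarrow> local_monoid G e \<cong> integer_group"
    and min: "minimal G X s"
  shows "faithful G X s"
  unfolding faithful_def
proof (intro ballI impI, rule ccontr)
  fix e n
  assume e: "e \<in> Ob G" and n: "n \<in> carrier (local_monoid G e)" "n \<noteq> e"
    and "\<not> (\<exists>p\<in>topspace (X e). s n p \<noteq> p)"
  then have triv: "s n p = p" if "p \<in> topspace (X e)" for p using that by blast
  define L where "L = carrier (local_monoid G e)"
  have eM: "e \<in> Mor G" "Dom G e = e" "Cod G e = e"
    using e Ob_subset Dom_Ob Cod_Ob by auto
  have L: "l \<in> L \<longleftrightarrow> l \<in> Mor G \<and> Dom G l = e \<and> Cod G l = e" for l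
    by (auto simp: L_def local_monoid_def)
  obtain h where "h \<in> iso (local_monoid G e) integer_group"
    using cyclic [OF e] by (auto simp: is_iso_def)
  then have bij: "bij_betw h L UNIV"
    and hom: "\<And>x y. x \<in> L \<Longrightarrow> y \<in> L \<Longrightarrow> h (x \<cdot> y) = h x + h y"
    by (auto simp: iso_def hom_def L_def local_monoid_def)
  define g where "g = inv_into L h"
  have gL: "g i \<in> L" and hg: "h (g i) = i" for i
    using bij unfolding g_def bij_betw_def by (auto intro: inv_into_into f_inv_into_f)
  have gh: "g (h x) = x" if "x \<in> L" for x
    using bij that unfolding g_def bij_betw_def by simp
  have g_add: "g (i + j) = g i \<cdot> g j" for i j
  proof -
    have "g i \<cdot> g j \<in> L" using gL [of i] gL [of j] Comp_closed Dom_Comp Cod_Comp by (auto simp: L)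
    then show ?thesis using gh [of "g i \<cdot> g j"] hom [OF gL gL, of i j] by (simp add: hg)
  qed
  obtain p where p: "p \<in> topspace (X e)" using infinite [OF e] by (metis finite.emptyI ex_in_conv)
  have gX: "s (g i) q \<in> topspace (X e)" if "q \<in> topspace (X e)" for i q
    using s_closed [of "g i" q] gL [of i] that by (simp add: L)
  have s_add: "s (g (i + j)) q = s (g j) (s (g i) q)" if "q \<in> topspace (X e)" for i j q
    unfolding g_add using s_Comp [of "g i" "g j" q] gL [of i] gL [of j] that
    by (simp add: L composable_def)
  \<comment> \<open>The trivially acting \<open>n\<close> is \<open>g k\<close>, so \<open>k\<close> is a period of the orbit of \<open>p\<close>.\<close>
  define k where "k = h n"
  have gk: "g k = n" using gh n by (simp add: k_def L_def)
  have "h e = 0" using hom [of e e] Comp_Dom [OF eM(1)] eM by (simp add: L)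
  then have "k \<noteq> 0" using gh [of e] gk n(2) eM by (auto simp: L)
  have shift: "s (g (j + k)) p = s (g j) p" for j
    using s_add [OF p, of k j] gk triv [OF p] by (simp add: add.commute)
  have periodic: "s (g (j + i * k)) p = s (g j) p" for i j
  proof (induction i rule: int_induct [of _ 0])
    case (step1 i)
    then show ?case using shift [of "j + i * k"] by (simp add: algebra_simps)
  next
    case (step2 i)
    then show ?case using shift [of "j + (i - 1) * k"] by (simp add: algebra_simps)
  qed simp
  define Y where "Y = (\<lambda>i. s (g i) p) ` UNIV"
  have "Y \<subseteq> (\<lambda>i. s (g i) p) ` {- \<bar>k\<bar>..\<bar>k\<bar>}"
  proof
    fix y assume "y \<in> Y"
    then obtain j where "y = s (g j) p" by (auto simp: Y_def)
    then have "y = s (g (j mod k)) p"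
      using periodic [of "j mod k" "j div k"] by (simp add: mod_div_mult_eq)
    moreover have "j mod k \<in> {- \<bar>k\<bar>..\<bar>k\<bar>}"
      using abs_mod_less [OF \<open>k \<noteq> 0\<close>, of j] by auto
    ultimately show "y \<in> (\<lambda>i. s (g i) p) ` {- \<bar>k\<bar>..\<bar>k\<bar>}" by blast
  qed
  then have fin: "finite Y" using finite_surj [of "{- \<bar>k\<bar>..\<bar>k\<bar>}"] by blast
  have YX: "Y \<subseteq> topspace (X e)" using gX [OF p] by (auto simp: Y_def)
  have "closedin (X e) Y"
    using fin YX Hausdorff [OF e] Hausdorff_imp_t1_space t1_space_closedin_finite by blast
  moreover have "s m ` Y \<subseteq> Y" if "m \<in> L" for m
    using s_add [OF p, of _ "h m"] gh [OF that] by (auto simp: Y_def) (metis rangeI)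
  moreover have "Y \<noteq> {}" by (auto simp: Y_def)
  ultimately have "Y = topspace (X e)" using min e unfolding minimal_def L_def by blast
  then show False using fin infinite [OF e] by simp
qed

lemma locally_abelian_if_infinite_cyclic:
  assumes "\<And>e. e \<in> Ob G \<Longrightarrow> local_monoid G e \<cong> integer_group"
  shows "locally_abelian G"
  unfolding locally_abelian_def
proof
  fix e assume e: "e \<in> Ob G"
  have eM: "e \<in> Mor G" "Dom G e = e" "Cod G e = e"
    using e Ob_subset Dom_Ob Cod_Ob by auto
  define L where "L = carrier (local_monoid G e)"
  obtain h where "h \<in> iso (local_monoid G e) integer_group"
    using assms [OF e] by (auto simp: is_iso_def)
  then have inj: "inj_on h L"
    and hom: "\<And>x y. x \<in> L \<Longrightarrow> y \<in> L \<Longrightarrow> h (x \<cdot> y) = h x + h y"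
    by (auto simp: iso_def hom_def L_def local_monoid_def bij_betw_def)
  have L: "l \<in> L \<longleftrightarrow> l \<in> Mor G \<and> Dom G l = e \<and> Cod G l = e" for l
    by (auto simp: L_def local_monoid_def)
  have closed: "x \<cdot> y \<in> L" if "x \<in> L" "y \<in> L" for x y
    using that Comp_closed Dom_Comp Cod_Comp by (auto simp: L)
  have comm: "x \<cdot> y = y \<cdot> x" if "x \<in> L" "y \<in> L" for x y
    using inj closed [OF that] closed [OF that(2,1)] hom [OF that] hom [OF that(2,1)]
    by (metis add.commute inj_onD)
  show "comm_monoid (local_monoid G e)"
  proof (rule comm_monoidI)
    fix x y z
    assume "x \<in> carrier (local_monoid G e)" "y \<in> carrier (local_monoid G e)"
      "z \<in> carrier (local_monoid G e)"
    then show "x \<otimes>\<^bsub>local_monoid G e\<^esub> y \<otimes>\<^bsub>local_monoid G e\<^esub> z =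
        x \<otimes>\<^bsub>local_monoid G e\<^esub> (y \<otimes>\<^bsub>local_monoid G e\<^esub> z)"
      using Comp_assoc by (auto simp: local_monoid_def)
  next
    fix x assume "x \<in> carrier (local_monoid G e)"
    then show "\<one>\<^bsub>local_monoid G e\<^esub> \<otimes>\<^bsub>local_monoid G e\<^esub> x = x"
      using Cod_Comp_left [of x] by (auto simp: local_monoid_def)
  qed (use closed comm eM in \<open>auto simp: L_def local_monoid_def\<close>)
qed

end

theorem theorem3:
  fixes G :: "'m category"
    and X :: "'m \<Rightarrow> 'x topology"
    and s :: "'m \<Rightarrow> 'x \<Rightarrow> 'x"
  assumes "category_dynamical_system G X s"
    and "\<And>e. e \<in> Ob G \<Longrightarrow>
      topspace (X e) \<noteq> {} \<and> compact_space (X e) \<and> Hausdorff_space (X e)"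
  shows
    "(simple_ring (skew_category_algebra G X s) \<longrightarrow>
        inverse_connected G \<and> minimal G X s \<and> faithful G X s) \<and>
     (groupoid G \<and> locally_abelian G \<longrightarrow>
        (simple_ring (skew_category_algebra G X s) \<longleftrightarrow>
          inverse_connected G \<and> minimal G X s \<and> faithful G X s)) \<and>
     (groupoid G \<and>
        (\<forall>e \<in> Ob G. infinite (topspace (X e)) \<and> local_monoid G e \<cong> integer_group) \<longrightarrow>
        (simple_ring (skew_category_algebra G X s) \<longleftrightarrow>
          inverse_connected G \<and> minimal G X s))"
proof -
  interpret category_dynamical_system G X s by fact
  have compact_Hausdorff: "\<And>e. e \<in> Ob G \<Longrightarrow> compact_space (X e) \<and> Hausdorff_space (X e)"
    and nonempty: "\<And>e. e \<in> Ob G \<Longrightarrow> topspace (X e) \<noteq> {}"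
    using assms(2) by auto
  have necessary: "inverse_connected G \<and> minimal G X s \<and> faithful G X s" if "simple_ring A"
    using simple_imp_inverse_connected [OF nonempty that] simple_imp_faithful [OF nonempty that]
      simple_imp_minimal [OF compact_Hausdorff that] by blast
  have sufficient: "simple_ring A"
    if "groupoid G" "locally_abelian G" "inverse_connected G" "minimal G X s" "faithful G X s"
    using simple_if_minimal_faithful [OF that(1) compact_Hausdorff that(2-5)] .
  have cyclic: "locally_abelian G" "minimal G X s \<Longrightarrow> faithful G X s"
    if "\<forall>e\<in>Ob G. infinite (topspace (X e)) \<and> local_monoid G e \<cong> integer_group"
    using that locally_abelian_if_infinite_cyclic faithful_if_infinite_cyclic compact_Hausdorff
    by blast+
  show ?thesis using necessary sufficient cyclic by blast
qed

end
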